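(* Let $\mathcal K$ be a finite (possibly empty) set of positive integers. If $f$ is an extreme point of $\mathrm{ball}(H^1_{\mathcal K})$ and if $1/f\in L^1$, then $f$ is an exposed point of $\mathrm{ball}(H^1_{\mathcal K})$.
   Context: Let $\mathbb T$ be the unit circle with normalized arc length measure, $L^1=L^1(\mathbb T)$ (complex-valued functions), $\|f\|_1=\frac1{2\pi}\int_{\mathbb T}|f(\zeta)|\,|d\zeta|$, and $\widehat f(k)=\frac1{2\pi}\int_{\mathbb T}\overline\zeta^{\,k}f(\zeta)\,|d\zeta|$ for $f\in L^1$, $k\in\mathbb Z$. The Hardy space is $H^1=\{f\in L^1:\widehat f(k)=0\text{ for all }k<0\}$, and the punctured Hardy space is $$H^1_{\mathcal K}=\{f\in H^1:\widehat f(k)=0\text{ for all }k\in\mathcal K\},$$ with norm $\|\cdot\|_1$ (so $H^1_\emptyset=H^1$). For a Banach space $X$, $\mathrm{ball}(X)=\{x\in X:\|x\|\le1\}$. A point of $\mathrm{ball}(X)$ is extreme if it is not the midpoint of any nondegenerate line segment contained in $\mathrm{ball}(X)$. A point $x\in\mathrm{ball}(X)$ is exposed if there exists a functional $\phi\in X^*$ of norm $1$ such that $\{y\in\mathrm{ball}(X):\phi(y)=1\}=\{x\}$. *)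

theory Defs
  imports "HOL-Analysis.Analysis"
begin

text \<open>Normalized arc length on the unit circle, as a Borel measure on the plane
  concentrated on the circle.\<close>

definition circle_measure :: "complex measure" where
  "circle_measure = distr (uniform_measure lborel {0..<2 * pi}) borel cis"

lemma sets_circle_measure [measurable_cong, simp]: "sets circle_measure = sets borel"
  by (simp add: circle_measure_def)

lemma integral_circle_measure:
  fixes f :: "complex \<Rightarrow> complex"
  assumes [measurable]: "f \<in> borel_measurable borel"
  shows "integral\<^sup>L circle_measure f = (LBINT t:{0..<2 * pi}. f (cis t)) / (2 * pi)"
proof -
  have [measurable]: "cis \<in> borel_measurable borel"
    by (intro borel_measurable_continuous_onI continuous_intros)
  have density: "indicator {0..<2 * pi} t / emeasure lborel {0..<2 * pi}
      = ennreal (indicator {0..<2 * pi} t / (2 * pi))" for t :: real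
    by (auto simp: indicator_def divide_ennreal simp flip: ennreal_1)
  have "integral\<^sup>L circle_measure f = (LINT t|uniform_measure lborel {0..<2 * pi}. f (cis t))"
    unfolding circle_measure_def by (rule integral_distr) measurable
  also have "\<dots> = (LINT t|lborel. (indicator {0..<2 * pi} t / (2 * pi)) *\<^sub>R f (cis t))"
    unfolding uniform_measure_def density by (rule integral_density) auto
  also have "\<dots> = (LINT t|lborel. (indicator {0..<2 * pi} t *\<^sub>R f (cis t)) / (2 * pi))"
    by (rule Bochner_Integration.integral_cong) (auto simp: scaleR_conv_of_real)
  finally show ?thesis
    by (simp add: set_lebesgue_integral_def)
qed

lemma AE_circle_measure_norm: "AE \<zeta> in circle_measure. norm \<zeta> = 1"
proof -
  have "cis \<in> borel_measurable borel"
    by (intro borel_measurable_continuous_onI continuous_intros)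
  then show ?thesis
    unfolding circle_measure_def by (subst AE_distr_iff) auto
qed

text \<open>The space of classes of integrable functions on the circle modulo equality
  almost everywhere.\<close>

quotient_type circle_L1 = "complex \<Rightarrow> complex" / partial:
  "\<lambda>f g. integrable circle_measure f \<and> integrable circle_measure g \<and>
    (AE \<zeta> in circle_measure. f \<zeta> = g \<zeta>)"
proof (rule part_equivpI)
  show "\<exists>f. integrable circle_measure f \<and> integrable circle_measure f \<and>
      (AE \<zeta> in circle_measure. f \<zeta> = (f \<zeta> :: complex))"
    by (rule exI[of _ "\<lambda>_. 0"]) simp
next
  show "symp (\<lambda>f g. integrable circle_measure f \<and> integrable circle_measure g \<and>
      (AE \<zeta> in circle_measure. f \<zeta> = (g \<zeta> :: complex)))"
    by (rule sympI) (auto simp: eq_commute)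
next
  show "transp (\<lambda>f g. integrable circle_measure f \<and> integrable circle_measure g \<and>
      (AE \<zeta> in circle_measure. f \<zeta> = (g \<zeta> :: complex)))"
    by (rule transpI) (auto elim: eventually_elim2)
qed

instantiation circle_L1 :: real_normed_vector
begin

lift_definition zero_circle_L1 :: circle_L1 is "\<lambda>_. 0" by simp

lift_definition plus_circle_L1 :: "circle_L1 \<Rightarrow> circle_L1 \<Rightarrow> circle_L1" is "\<lambda>f g \<zeta>. f \<zeta> + g \<zeta>"
  by (auto elim: eventually_elim2)

lift_definition minus_circle_L1 :: "circle_L1 \<Rightarrow> circle_L1 \<Rightarrow> circle_L1" is "\<lambda>f g \<zeta>. f \<zeta> - g \<zeta>"
  by (auto elim: eventually_elim2)

lift_definition uminus_circle_L1 :: "circle_L1 \<Rightarrow> circle_L1" is "\<lambda>f \<zeta>. - f \<zeta>"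
  by auto

lift_definition scaleR_circle_L1 :: "real \<Rightarrow> circle_L1 \<Rightarrow> circle_L1" is "\<lambda>r f \<zeta>. r *\<^sub>R f \<zeta>"
  by auto

lift_definition norm_circle_L1 :: "circle_L1 \<Rightarrow> real" is "\<lambda>f. LINT \<zeta>|circle_measure. norm (f \<zeta>)"
  by (rule integral_cong_AE) auto

definition dist_circle_L1 :: "circle_L1 \<Rightarrow> circle_L1 \<Rightarrow> real" where
  "dist_circle_L1 f g = norm (f - g)"

definition sgn_circle_L1 :: "circle_L1 \<Rightarrow> circle_L1" where
  "sgn_circle_L1 f = inverse (norm f) *\<^sub>R f"

definition uniformity_circle_L1 :: "(circle_L1 \<times> circle_L1) filter" where
  "uniformity_circle_L1 = (INF e\<in>{0<..}. principal {(f, g). dist f g < e})"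

definition open_circle_L1 :: "circle_L1 set \<Rightarrow> bool" where
  "open_circle_L1 U \<longleftrightarrow> (\<forall>f\<in>U. \<forall>\<^sub>F (f', g) in uniformity. f' = f \<longrightarrow> g \<in> U)"

instance
proof
  fix f g h :: circle_L1 and a b :: real and U :: "circle_L1 set"
  show "f + g + h = f + (g + h)" by transfer (auto simp: add.assoc)
  show "f + g = g + f" by transfer (auto simp: add.commute)
  show "0 + f = f" by transfer auto
  show "- f + f = 0" by transfer auto
  show "f - g = f + - g" by transfer auto
  show "a *\<^sub>R (f + g) = a *\<^sub>R f + a *\<^sub>R g" by transfer (auto simp: scaleR_add_right)
  show "(a + b) *\<^sub>R f = a *\<^sub>R f + b *\<^sub>R f" by transfer (auto simp: scaleR_add_left)
  show "a *\<^sub>R b *\<^sub>R f = (a * b) *\<^sub>R f" by transfer auto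
  show "1 *\<^sub>R f = f" by transfer auto
  show "dist f g = norm (f - g)" by (rule dist_circle_L1_def)
  show "sgn f = inverse (norm f) *\<^sub>R f" by (rule sgn_circle_L1_def)
  show "uniformity = (INF e\<in>{0<..}. principal {(f, g :: circle_L1). dist f g < e})"
    by (rule uniformity_circle_L1_def)
  show "open U \<longleftrightarrow> (\<forall>f\<in>U. \<forall>\<^sub>F (f', g) in uniformity. f' = f \<longrightarrow> g \<in> U)"
    by (rule open_circle_L1_def)
  show "norm f = 0 \<longleftrightarrow> f = 0"
    by transfer (auto simp: integral_nonneg_eq_0_iff_AE)
  show "norm (f + g) \<le> norm f + norm g"
  proof transfer
    fix f g :: "complex \<Rightarrow> complex"
    assume "integrable circle_measure f \<and> integrable circle_measure f \<and>
        (AE \<zeta> in circle_measure. f \<zeta> = f \<zeta>)"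
      and "integrable circle_measure g \<and> integrable circle_measure g \<and>
        (AE \<zeta> in circle_measure. g \<zeta> = g \<zeta>)"
    then have [simp]: "integrable circle_measure f" "integrable circle_measure g"
      by auto
    have "(LINT \<zeta>|circle_measure. norm (f \<zeta> + g \<zeta>)) \<le>
        (LINT \<zeta>|circle_measure. norm (f \<zeta>) + norm (g \<zeta>))"
      by (rule integral_mono) (auto intro: norm_triangle_ineq)
    then show "(LINT \<zeta>|circle_measure. norm (f \<zeta> + g \<zeta>)) \<le>
        (LINT \<zeta>|circle_measure. norm (f \<zeta>)) + (LINT \<zeta>|circle_measure. norm (g \<zeta>))"
      by simp
  qed
  show "norm (a *\<^sub>R f) = \<bar>a\<bar> * norm f" by transfer simp
qed

end

lift_definition scaleC :: "complex \<Rightarrow> circle_L1 \<Rightarrow> circle_L1" is "\<lambda>c f \<zeta>. c * f \<zeta>"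
  by auto

lift_definition fourier_coeff :: "circle_L1 \<Rightarrow> int \<Rightarrow> complex" is
  "\<lambda>f k. LINT \<zeta>|circle_measure. cnj \<zeta> powi k * f \<zeta>"
proof -
  fix f g :: "complex \<Rightarrow> complex"
  assume "integrable circle_measure f \<and> integrable circle_measure g \<and>
    (AE \<zeta> in circle_measure. f \<zeta> = g \<zeta>)"
  then have [measurable]: "f \<in> borel_measurable circle_measure"
      "g \<in> borel_measurable circle_measure"
    and eq: "AE \<zeta> in circle_measure. f \<zeta> = g \<zeta>"
    by auto
  have [measurable]: "(\<lambda>\<zeta>. cnj \<zeta> powi k) \<in> borel_measurable circle_measure" for k :: int
  proof -
    have [measurable]: "cnj \<in> borel_measurable borel"
      by (intro borel_measurable_continuous_onI continuous_intros)
    have "(\<lambda>\<zeta>. cnj \<zeta> powi k) \<in> borel_measurable borel"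
      unfolding power_int_def by (cases "k \<ge> 0") simp_all
    then show ?thesis
      by (simp cong: measurable_cong_sets)
  qed
  show "(\<lambda>k. LINT \<zeta>|circle_measure. cnj \<zeta> powi k * f \<zeta>) =
      (\<lambda>k. LINT \<zeta>|circle_measure. cnj \<zeta> powi k * g \<zeta>)"
    by (intro ext integral_cong_AE) (use eq in \<open>auto elim: eventually_mono\<close>)
qed

text \<open>Since \<open>1 / 0 = 0\<close> in HOL, \<open>f \<noteq> 0\<close> almost everywhere has to be stated explicitly: it is
  what makes \<open>1 / f\<close> an almost everywhere defined function.\<close>

lift_definition reciprocal_in_L1 :: "circle_L1 \<Rightarrow> bool" is
  "\<lambda>f. (AE \<zeta> in circle_measure. f \<zeta> \<noteq> 0) \<and> integrable circle_measure (\<lambda>\<zeta>. 1 / f \<zeta>)"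
proof -
  fix f g :: "complex \<Rightarrow> complex"
  assume "integrable circle_measure f \<and> integrable circle_measure g \<and>
    (AE \<zeta> in circle_measure. f \<zeta> = g \<zeta>)"
  then have [measurable]: "f \<in> borel_measurable circle_measure"
      "g \<in> borel_measurable circle_measure"
    and eq: "AE \<zeta> in circle_measure. f \<zeta> = g \<zeta>"
    by auto
  have "(AE \<zeta> in circle_measure. f \<zeta> \<noteq> 0) \<longleftrightarrow> (AE \<zeta> in circle_measure. g \<zeta> \<noteq> 0)"
    using eq by (auto elim: eventually_elim2)
  moreover have "integrable circle_measure (\<lambda>\<zeta>. 1 / f \<zeta>) \<longleftrightarrow>
      integrable circle_measure (\<lambda>\<zeta>. 1 / g \<zeta>)"
    by (rule integrable_cong_AE) (use eq in \<open>auto elim: eventually_mono\<close>)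
  ultimately show "((AE \<zeta> in circle_measure. f \<zeta> \<noteq> 0) \<and>
        integrable circle_measure (\<lambda>\<zeta>. 1 / f \<zeta>)) =
      ((AE \<zeta> in circle_measure. g \<zeta> \<noteq> 0) \<and>
        integrable circle_measure (\<lambda>\<zeta>. 1 / g \<zeta>))"
    by blast
qed

definition hardy_H1 :: "circle_L1 set" where
  "hardy_H1 = {f. \<forall>k<0. fourier_coeff f k = 0}"

definition punctured_H1 :: "int set \<Rightarrow> circle_L1 set" where
  "punctured_H1 K = {f \<in> hardy_H1. \<forall>k\<in>K. fourier_coeff f k = 0}"

text \<open>In the following definitions \<open>X\<close> is a complex linear subspace with the inherited norm.
  A functional on \<open>X\<close> is a function on the whole type of which only the values on \<open>X\<close> matter; boundedness makes the supremum in \<open>dual_norm\<close> a genuine one.\<close>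

definition unit_ball_of :: "circle_L1 set \<Rightarrow> circle_L1 set" where
  "unit_ball_of X = X \<inter> cball 0 1"

definition dual_space :: "circle_L1 set \<Rightarrow> (circle_L1 \<Rightarrow> complex) set" where
  "dual_space X = {\<phi>.
     (\<forall>f\<in>X. \<forall>g\<in>X. \<phi> (f + g) = \<phi> f + \<phi> g) \<and>
     (\<forall>c. \<forall>f\<in>X. \<phi> (scaleC c f) = c * \<phi> f) \<and>
     (\<exists>B. \<forall>f\<in>X. norm (\<phi> f) \<le> B * norm f)}"

definition dual_norm :: "circle_L1 set \<Rightarrow> (circle_L1 \<Rightarrow> complex) \<Rightarrow> real" where
  "dual_norm X \<phi> = (SUP f\<in>unit_ball_of X. norm (\<phi> f))"

definition exposed_point_of_ball :: "circle_L1 \<Rightarrow> circle_L1 set \<Rightarrow> bool" where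
  "exposed_point_of_ball f X \<longleftrightarrow>
     f \<in> unit_ball_of X \<and>
     (\<exists>\<phi>\<in>dual_space X. dual_norm X \<phi> = 1 \<and> {g \<in> unit_ball_of X. \<phi> g = 1} = {f})"

end

theory Submission
  imports Defs
begin

text \<open>Integration against the conjugate of \<open>sgn f\<close> is a functional of norm 1 that takes the value 1 at
  \<open>f\<close>. If it takes the value 1 at another \<open>g\<close> in the ball, then \<open>g = h f\<close> with \<open>h \<ge> 0\<close>, and it
  has to be shown that \<open>h\<close> is constant; the constant is then 1, the integral of \<open>|g|\<close> being 1.
  For bounded \<open>h\<close> this is extremality: with \<open>c\<close> the integral of \<open>h |f|\<close> and a small \<open>e\<close>, both of \<open>f \<plusminus> e (h - c) f\<close> lie in the ball
  (\<open>bounded_multiplier_constant\<close>). So everything rests on showing that \<open>h\<close> is bounded.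

  Since \<open>f\<close> and \<open>1/f\<close> are integrable, there is \<open>q\<close> with \<open>|q|\<^sup>2 |f| = 1\<close> such that \<open>q\<close>, \<open>1/q\<close>
  and \<open>f q\<close> belong to \<open>H\<^sup>2\<close> (\<open>outer_factor_exists\<close>). This is the outer function of modulus
  \<open>|f|\<close> to the power -1/2; it comes out of Szego's extremal problem, an orthogonal projection in
  \<open>L\<^sup>2\<close>. Hence \<open>u = f q\<^sup>2\<close> is a unimodular function in \<open>H\<^sup>1\<close>, the inner factor
  of \<open>f\<close>.

  Extremality forces \<open>u\<close> to be a quotient of polynomials
  (\<open>rational_symbol_if_bounded_multipliers_constant\<close>). Indeed, let \<open>W n\<close> be the \<open>n\<close>-th backward shift
  of \<open>u\<close>. Because \<open>u\<close> is unimodular, \<open>u cnj (W n)\<close> is again analytic, and so the products of \<open>f\<close>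
  with the real and the imaginary part of \<open>W n\<close> are in \<open>H\<^sup>1\<close>. The conditions at \<open>K\<close> are
  \<open>2 |K|\<close> real linear equations, so that some nontrivial real combination of these parts, for
  \<open>n \<le> |K|\<close>, multiplies \<open>f\<close> into the punctured space. It is constant by extremality, and the
  resulting linear relation between the \<open>W n\<close> reads \<open>u t = p\<close> with polynomials \<open>t \<noteq> 0\<close> and
  \<open>p\<close>. After cancellation \<open>p\<close> has no zero on the circle, since \<open>|p| = |t|\<close> there
  (\<open>rational_symbol_without_zeros\<close>).

  Now write \<open>g\<close> for the function \<open>(1 + h) f\<close> instead, and let \<open>s\<close> be for \<open>g\<close> what \<open>q\<close> is for \<open>f\<close>; it
  exists because \<open>|1/g| \<le> |1/f|\<close>. The function \<open>W = q/s\<close> is in \<open>H\<^sup>1\<close>, it satisfies \<open>|W|\<^sup>2 = 1 + h\<close>, and \<open>u cnj W = g s q\<close>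
  is in \<open>H\<^sup>1\<close> as well. Therefore \<open>p cnj W = t u cnj W\<close> is in \<open>H\<^sup>1\<close>, while its
  conjugate \<open>cnj p W\<close> has only finitely many negative frequencies. So \<open>p cnj W\<close> is a trigonometric
  polynomial, hence bounded, and with it \<open>W\<close> and \<open>h\<close> (\<open>positive_multiple_bounded\<close>).\<close>

section \<open>Orthogonal projection in the space of square integrable functions\<close>

definition square_integrable :: "'a measure \<Rightarrow> ('a \<Rightarrow> complex) \<Rightarrow> bool" where
  "square_integrable M f \<longleftrightarrow> f \<in> borel_measurable M \<and> integrable M (\<lambda>x. (norm (f x))\<^sup>2)"

lemma measurable_cnj [measurable]: "cnj \<in> borel_measurable borel"
  by (intro borel_measurable_continuous_onI continuous_intros)

lemma square_integrable_measurable [measurable_dest]: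
  "square_integrable M f \<Longrightarrow> f \<in> borel_measurable M"
  by (simp add: square_integrable_def)

lemma square_integrable_norm2:
  "square_integrable M f \<Longrightarrow> integrable M (\<lambda>x. (norm (f x))\<^sup>2)"
  by (simp add: square_integrable_def)

lemma square_integrable_bound:
  assumes "f \<in> borel_measurable M" "integrable M g"
    and "AE x in M. (norm (f x))\<^sup>2 \<le> g x"
  shows "square_integrable M f"
  unfolding square_integrable_def
  using assms by (auto intro!: Bochner_Integration.integrable_bound[of M g])

lemma integrable_mult_square_integrable:
  assumes "square_integrable M f" "square_integrable M g"
  shows "integrable M (\<lambda>x. f x * g x)"
proof (rule Bochner_Integration.integrable_bound)
  show "integrable M (\<lambda>x. (norm (f x))\<^sup>2 + (norm (g x))\<^sup>2)"
    using assms by (simp add: square_integrable_def)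
  show "(\<lambda>x. f x * g x) \<in> borel_measurable M"
    using assms[THEN square_integrable_measurable] by measurable
  have "norm a * norm b \<le> (norm a)\<^sup>2 + (norm b)\<^sup>2" for a b :: complex
    using sum_squares_bound[of "norm a" "norm b"] by (simp add: mult.assoc)
      (smt (verit) mult_nonneg_nonneg norm_ge_zero)
  then show "AE x in M. norm (f x * g x) \<le> norm ((norm (f x))\<^sup>2 + (norm (g x))\<^sup>2)"
    by (simp add: norm_mult)
qed

lemma square_integrable_add:
  assumes "square_integrable M f" "square_integrable M g"
  shows "square_integrable M (\<lambda>x. f x + g x)"
proof (rule square_integrable_bound)
  show "(\<lambda>x. f x + g x) \<in> borel_measurable M"
    using assms[THEN square_integrable_measurable] by measurable
  show "integrable M (\<lambda>x. 2 * (norm (f x))\<^sup>2 + 2 * (norm (g x))\<^sup>2)"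
    using assms by (simp add: square_integrable_def)
  have "(norm (a + b))\<^sup>2 \<le> 2 * (norm a)\<^sup>2 + 2 * (norm b)\<^sup>2" for a b :: complex
  proof -
    have "(norm (a + b))\<^sup>2 \<le> (norm a + norm b)\<^sup>2"
      by (intro power_mono norm_triangle_ineq norm_ge_zero)
    also have "\<dots> \<le> 2 * (norm a)\<^sup>2 + 2 * (norm b)\<^sup>2"
      using sum_squares_bound[of "norm a" "norm b"] by (simp add: power2_sum)
    finally show ?thesis .
  qed
  then show "AE x in M. (norm (f x + g x))\<^sup>2 \<le> 2 * (norm (f x))\<^sup>2 + 2 * (norm (g x))\<^sup>2"
    by simp
qed

lemma square_integrable_mult_bounded:
  assumes [measurable]: "h \<in> borel_measurable M" and "square_integrable M f"
    and "AE x in M. norm (h x) \<le> C"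
  shows "square_integrable M (\<lambda>x. h x * f x)"
proof (rule square_integrable_bound)
  show "(\<lambda>x. h x * f x) \<in> borel_measurable M"
    using assms(2)[THEN square_integrable_measurable] by measurable
  show "integrable M (\<lambda>x. C\<^sup>2 * (norm (f x))\<^sup>2)"
    using assms by (simp add: square_integrable_def)
  show "AE x in M. (norm (h x * f x))\<^sup>2 \<le> C\<^sup>2 * (norm (f x))\<^sup>2"
    using assms(3) by eventually_elim (simp add: norm_mult power_mult_distrib power_mono mult_right_mono)
qed

lemma square_integrable_cmult:
  "square_integrable M f \<Longrightarrow> square_integrable M (\<lambda>x. c * f x)"
  by (rule square_integrable_mult_bounded[where C = "norm c"]) auto

lemma square_integrable_diff:
  assumes "square_integrable M f" "square_integrable M g"
  shows "square_integrable M (\<lambda>x. f x - g x)"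
  using square_integrable_add[OF assms(1) square_integrable_cmult[OF assms(2), of "-1"]] by simp

lemma square_integrable_cnj:
  assumes "square_integrable M f"
  shows "square_integrable M (\<lambda>x. cnj (f x))"
proof -
  note [measurable] = square_integrable_measurable[OF assms]
  have "(\<lambda>x. cnj (f x)) \<in> borel_measurable M" by measurable
  then show ?thesis using assms by (simp add: square_integrable_def)
qed

lemma (in finite_measure) square_integrable_const: "square_integrable M (\<lambda>_. c)"
  by (simp add: square_integrable_def)

lemma (in finite_measure) square_integrable_integrable:
  "square_integrable M f \<Longrightarrow> integrable M f"
  using integrable_mult_square_integrable[OF square_integrable_const[of 1]] by simp

text \<open>By Fatou's lemma. A minimizing sequence comes with bounds on its norms but with no dominating
  function.\<close>

lemma square_integrable_limit:
  assumes g: "\<And>n. square_integrable M (g n)" and G [measurable]: "G \<in> borel_measurable M"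
    and lim: "AE x in M. (\<lambda>n. g n x) \<longlonglongrightarrow> G x"
    and le: "\<And>n. (LINT x|M. (norm (g n x))\<^sup>2) \<le> C"
  shows "square_integrable M G" "(LINT x|M. (norm (G x))\<^sup>2) \<le> C"
proof -
  note [measurable] = g[THEN square_integrable_measurable]
  have "0 \<le> (LINT x|M. (norm (g 0 x))\<^sup>2)" by simp
  then have C: "0 \<le> C" using le[of 0] by linarith
  have nn: "(\<integral>\<^sup>+x. ennreal ((norm (g n x))\<^sup>2) \<partial>M) \<le> ennreal C" for n
    using le[of n] C square_integrable_norm2[OF g]
    by (subst nn_integral_eq_integral) (auto intro: ennreal_leI)
  have "AE x in M. ennreal ((norm (G x))\<^sup>2) = liminf (\<lambda>n. ennreal ((norm (g n x))\<^sup>2))"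
    using lim
  proof eventually_elim
    case (elim x)
    then have "(\<lambda>n. ennreal ((norm (g n x))\<^sup>2)) \<longlonglongrightarrow> ennreal ((norm (G x))\<^sup>2)"
      by (intro tendsto_intros)
    then show ?case by (rule lim_imp_Liminf[symmetric, rotated]) simp
  qed
  then have "(\<integral>\<^sup>+x. ennreal ((norm (G x))\<^sup>2) \<partial>M) =
      (\<integral>\<^sup>+x. liminf (\<lambda>n. ennreal ((norm (g n x))\<^sup>2)) \<partial>M)"
    by (rule nn_integral_cong_AE)
  also have "\<dots> \<le> liminf (\<lambda>n. \<integral>\<^sup>+x. ennreal ((norm (g n x))\<^sup>2) \<partial>M)"
    by (rule nn_integral_liminf) measurable
  also have "\<dots> \<le> liminf (\<lambda>n::nat. ennreal C)"
    by (intro Liminf_mono always_eventually allI nn)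
  also have "\<dots> = ennreal C" by (simp add: Liminf_const)
  finally have *: "(\<integral>\<^sup>+x. ennreal ((norm (G x))\<^sup>2) \<partial>M) \<le> ennreal C" .
  then have int: "integrable M (\<lambda>x. (norm (G x))\<^sup>2)"
    by (intro integrableI_nonneg) (auto simp: less_top[symmetric] top_unique)
  then show "square_integrable M G" by (simp add: square_integrable_def)
  show "(LINT x|M. (norm (G x))\<^sup>2) \<le> C"
    using * C int by (subst (asm) nn_integral_eq_integral) (auto simp: ennreal_le_iff)
qed

lemma AE_convergent_if_summable_increments:
  fixes r :: "nat \<Rightarrow> 'a \<Rightarrow> complex"
  assumes r: "\<And>n. integrable M (r n)"
    and sum: "summable (\<lambda>n. LINT x|M. norm (r (Suc n) x - r n x))"
  shows "AE x in M. convergent (\<lambda>n. r n x)"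
proof -
  note [measurable] = borel_measurable_integrable[OF r]
  have "(\<integral>\<^sup>+x. (\<Sum>n. ennreal (norm (r (Suc n) x - r n x))) \<partial>M) =
      (\<Sum>n. \<integral>\<^sup>+x. ennreal (norm (r (Suc n) x - r n x)) \<partial>M)"
    by (rule nn_integral_suminf) measurable
  also have "\<dots> = (\<Sum>n. ennreal (LINT x|M. norm (r (Suc n) x - r n x)))"
    using r by (subst nn_integral_eq_integral) auto
  also have "\<dots> \<noteq> \<infinity>"
    using sum by (subst suminf_ennreal2) auto
  finally have "AE x in M. (\<Sum>n. ennreal (norm (r (Suc n) x - r n x))) \<noteq> \<infinity>"
    by (intro nn_integral_noteq_infinite) auto
  then show ?thesis
  proof eventually_elim
    case (elim x)
    then have "summable (\<lambda>n. norm (r (Suc n) x - r n x))"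
      by (intro summable_suminf_not_top) auto
    then have "summable (\<lambda>n. r (Suc n) x - r n x)" by (rule summable_norm_cancel)
    then have "convergent (\<lambda>n. \<Sum>i<n. r (Suc i) x - r i x)"
      by (simp add: summable_iff_convergent)
    then have "convergent (\<lambda>n. r 0 x + (r n x - r 0 x))"
      using sum_lessThan_telescope[of "\<lambda>n. r n x"] by (intro convergent_add convergent_const) simp
    then show ?case by simp
  qed
qed

text \<open>A substitute for the Cauchy-Schwarz inequality: after integration, a geometric \<open>c\<close> turns bounds
  on the squares into summable bounds on the products.\<close>

lemma mult_le_weighted_squares:
  fixes c y z :: real
  assumes "0 < c" "0 \<le> y" "0 \<le> z"
  shows "y * z \<le> 1 / c * y\<^sup>2 + c * z\<^sup>2"
proof -
  have "0 \<le> (y - c * z)\<^sup>2" by simp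
  then have "2 * (y * z) * c \<le> y\<^sup>2 + (c * z)\<^sup>2"
    by (simp add: power2_diff mult_ac)
  also have "\<dots> = (1 / c * y\<^sup>2 + c * z\<^sup>2) * c"
    using assms(1) by (simp add: power2_eq_square field_simps)
  finally have "2 * (y * z) * c \<le> (1 / c * y\<^sup>2 + c * z\<^sup>2) * c" .
  then have "2 * (y * z) \<le> 1 / c * y\<^sup>2 + c * z\<^sup>2"
    using assms(1) by (rule mult_right_le_imp_le)
  moreover have "0 \<le> y * z" using assms by simp
  ultimately show ?thesis by linarith
qed

text \<open>A minimizing sequence for the distance to \<open>a\<close> is a Cauchy sequence by the parallelogram identity.
  With distances chosen geometrically small it converges almost everywhere, and Fatou's lemma makes
  the limit a minimizer; membership in the subspace survives because the conditions are continuous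
  in the mean square. Describing the subspace by such conditions instead of by a basis lets
  analyticity of products be one of them, as in the proofs of \<open>H1_function_mult\<close> and
  \<open>outer_factor_exists\<close>.\<close>

theorem (in finite_measure) orthogonal_projection_exists:
  fixes \<Psi> :: "('a \<Rightarrow> complex) set" and a :: "'a \<Rightarrow> complex"
  assumes \<Psi>: "\<And>\<psi>. \<psi> \<in> \<Psi> \<Longrightarrow> square_integrable M \<psi>" and a: "square_integrable M a"
  defines "V \<equiv> {r. square_integrable M r \<and> (\<forall>\<psi>\<in>\<Psi>. (LINT x|M. \<psi> x * r x) = 0)}"
  obtains b where "b \<in> V" "\<And>r. r \<in> V \<Longrightarrow> (LINT x|M. (a x - b x) * cnj (r x)) = 0"
proof -
  have V_si: "square_integrable M r" if "r \<in> V" for r using that by (simp add: V_def)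
  have V_lin: "(\<lambda>x. c * r x + d * s x) \<in> V" if "r \<in> V" "s \<in> V" for c d r s
  proof -
    have "(LINT x|M. \<psi> x * (c * r x + d * s x)) = 0" if "\<psi> \<in> \<Psi>" for \<psi>
    proof -
      have "integrable M (\<lambda>x. \<psi> x * r x)" "integrable M (\<lambda>x. \<psi> x * s x)"
        by (intro integrable_mult_square_integrable \<Psi> that V_si[OF \<open>r \<in> V\<close>] V_si[OF \<open>s \<in> V\<close>])+
      then have "(LINT x|M. c * (\<psi> x * r x) + d * (\<psi> x * s x)) = 0"
        using that \<open>r \<in> V\<close> \<open>s \<in> V\<close> by (simp add: V_def)
      then show ?thesis by (simp add: algebra_simps)
    qed
    then show ?thesis
      using that by (auto simp: V_def intro!: square_integrable_add square_integrable_cmult)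
  qed
  define D where "D r = (LINT x|M. (norm (a x - r x))\<^sup>2)" for r
  have D_nonneg: "0 \<le> D r" for r by (simp add: D_def)
  define d where "d = Inf (D ` V)"
  have bdd: "bdd_below (D ` V)" using D_nonneg by (auto intro!: bdd_belowI[of _ 0])
  have d_le: "d \<le> D r" if "r \<in> V" for r
    unfolding d_def using that bdd by (intro cInf_lower) auto
  have "(\<lambda>_. 0) \<in> V" by (auto simp: V_def square_integrable_const)
  then have "D ` V \<noteq> {}" by blast
  have "\<exists>r\<in>V. D r < d + (1/4)^n" for n :: nat
  proof -
    have "Inf (D ` V) < d + (1/4)^n" by (simp add: d_def)
    from cInf_lessD[OF \<open>D ` V \<noteq> {}\<close> this] show ?thesis by auto
  qed
  then obtain r where rV: "\<And>n. r n \<in> V" and rD: "\<And>n. D (r n) < d + (1/4)^n" by metis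
  note r_si = V_si[OF rV]
  note [measurable] = r_si[THEN square_integrable_measurable] a[THEN square_integrable_measurable]
  have gap: "(LINT x|M. (norm (r m x - r n x))\<^sup>2) \<le> 4 * (1/4)^n" if "n \<le> m" for m n
  proof -
    define s where "s x = (1/2) * r m x + (1/2) * r n x" for x
    have s: "s \<in> V" unfolding s_def by (intro V_lin rV)
    \<comment> \<open>the parallelogram identity, compared at the midpoint of two members of the sequence\<close>
    have eq: "(norm (x - y))\<^sup>2 = 2 * (norm (z - x))\<^sup>2 + 2 * (norm (z - y))\<^sup>2
        - 4 * (norm (z - ((1/2) * x + (1/2) * y)))\<^sup>2" for x y z :: complex
      unfolding cmod_power2 by (simp add: power2_eq_square field_simps)
    have int: "integrable M (\<lambda>x. (norm (a x - t x))\<^sup>2)" if "t \<in> V" for t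
      using that by (intro square_integrable_norm2 square_integrable_diff a V_si)
    have pt: "(norm (r m x - r n x))\<^sup>2 = 2 * (norm (a x - r m x))\<^sup>2
        + 2 * (norm (a x - r n x))\<^sup>2 - 4 * (norm (a x - s x))\<^sup>2" for x
      using eq[of "r m x" "r n x" "a x"] by (simp only: s_def)
    have "(LINT x|M. (norm (r m x - r n x))\<^sup>2) = (LINT x|M. 2 * (norm (a x - r m x))\<^sup>2
        + 2 * (norm (a x - r n x))\<^sup>2 - 4 * (norm (a x - s x))\<^sup>2)"
      by (simp only: pt)
    also have "\<dots> = 2 * D (r m) + 2 * D (r n) - 4 * D s"
      using int[OF rV] int[OF s] by (simp add: D_def)
    also have "\<dots> \<le> 2 * (1/4)^m + 2 * (1/4)^n"
      using rD[of m] rD[of n] d_le[OF s] by linarith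
    also have "(1/4::real)^m \<le> (1/4)^n" using that by (intro power_decreasing) auto
    finally show ?thesis by linarith
  qed
  have "summable (\<lambda>n. LINT x|M. norm (r (Suc n) x - r n x))"
  proof (rule summable_comparison_test')
    show "summable (\<lambda>n. (4 + measure M (space M)) * (1/2::real)^n)"
      by (intro summable_mult summable_geometric) simp
    fix n :: nat assume "0 \<le> n"
    have "(LINT x|M. norm (r (Suc n) x - r n x)) \<le>
        (LINT x|M. 2^n * (norm (r (Suc n) x - r n x))\<^sup>2 + (1/2)^n)"
    proof (rule integral_mono)
      show "integrable M (\<lambda>x. norm (r (Suc n) x - r n x))"
        by (intro integrable_norm square_integrable_integrable square_integrable_diff r_si)
      show "integrable M (\<lambda>x. 2^n * (norm (r (Suc n) x - r n x))\<^sup>2 + (1/2)^n)"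
        by (intro Bochner_Integration.integrable_add integrable_mult_right square_integrable_norm2 square_integrable_diff r_si) simp
      have "y \<le> 2^n * y\<^sup>2 + (1/2)^n" if "0 \<le> y" for y :: real
        using mult_le_weighted_squares[of "2^n" 1 y] that by (simp add: power_one_over field_simps)
      then show "norm (r (Suc n) x - r n x) \<le> 2^n * (norm (r (Suc n) x - r n x))\<^sup>2 + (1/2)^n" for x
        by simp
    qed
    also have "\<dots> = 2^n * (LINT x|M. (norm (r (Suc n) x - r n x))\<^sup>2) + (1/2)^n * measure M (space M)"
      using square_integrable_norm2[OF square_integrable_diff[OF r_si[of "Suc n"] r_si[of n]]] by simp
    also have "\<dots> \<le> 2^n * (4 * (1/4)^n) + (1/2)^n * measure M (space M)"
      by (intro add_right_mono mult_left_mono gap) auto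
    also have "2^n * (4 * (1/4)^n) = 4 * (1/2::real)^n"
      using power_mult_distrib[of 2 "1/4::real" n] by simp
    finally show "norm (LINT x|M. norm (r (Suc n) x - r n x)) \<le> (4 + measure M (space M)) * (1/2)^n"
      by (simp add: algebra_simps)
  qed
  then have conv: "AE x in M. convergent (\<lambda>n. r n x)"
    by (intro AE_convergent_if_summable_increments square_integrable_integrable r_si)
  define b where "b x = lim (\<lambda>n. r n x)" for x
  have [measurable]: "b \<in> borel_measurable M" unfolding b_def by measurable
  have lim: "AE x in M. (\<lambda>n. r n x) \<longlonglongrightarrow> b x"
    using conv by eventually_elim (simp add: b_def convergent_LIMSEQ_iff)
  have lim_diff: "square_integrable M (\<lambda>x. b x - r n x)"
      "(LINT x|M. (norm (b x - r n x))\<^sup>2) \<le> 4 * (1/4)^n" for n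
  proof -
    have *: "AE x in M. (\<lambda>m. r (m + n) x - r n x) \<longlonglongrightarrow> b x - r n x"
      using lim by eventually_elim (intro tendsto_intros LIMSEQ_ignore_initial_segment)
    show "square_integrable M (\<lambda>x. b x - r n x)"
        "(LINT x|M. (norm (b x - r n x))\<^sup>2) \<le> 4 * (1/4)^n"
      using square_integrable_limit[OF _ _ * gap] r_si by (auto intro: square_integrable_diff)
  qed
  have b_si: "square_integrable M b"
    using square_integrable_add[OF lim_diff(1)[of 0] r_si[of 0]] by simp
  have bV: "b \<in> V"
  proof -
    have "(LINT x|M. \<psi> x * b x) = 0" if "\<psi> \<in> \<Psi>" for \<psi>
    proof -
      note \<psi> = \<Psi>[OF that]
      have "norm (LINT x|M. \<psi> x * b x) \<le> ((LINT x|M. (norm (\<psi> x))\<^sup>2) + 4) * (1/2)^n" for n :: nat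
      proof -
        have int: "integrable M (\<lambda>x. \<psi> x * b x)" "integrable M (\<lambda>x. \<psi> x * r n x)"
            "integrable M (\<lambda>x. \<psi> x * (b x - r n x))"
          by (intro integrable_mult_square_integrable \<psi> b_si r_si lim_diff(1))+
        have "(LINT x|M. \<psi> x * r n x) = 0" using rV[of n] that by (auto simp: V_def)
        then have "(LINT x|M. \<psi> x * b x) = (LINT x|M. \<psi> x * (b x - r n x))"
          using int by (simp add: right_diff_distrib)
        also have "norm \<dots> \<le> (LINT x|M. norm (\<psi> x * (b x - r n x)))"
          by (rule integral_norm_bound)
        also have "\<dots> \<le> (LINT x|M. (1/2)^n * (norm (\<psi> x))\<^sup>2 + 2^n * (norm (b x - r n x))\<^sup>2)"
        proof (rule integral_mono)
          show "integrable M (\<lambda>x. norm (\<psi> x * (b x - r n x)))" using int by simp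
          show "integrable M (\<lambda>x. (1/2)^n * (norm (\<psi> x))\<^sup>2 + 2^n * (norm (b x - r n x))\<^sup>2)"
            by (intro Bochner_Integration.integrable_add integrable_mult_right square_integrable_norm2 \<psi> lim_diff)
          have "y * z \<le> (1/2)^n * y\<^sup>2 + 2^n * z\<^sup>2" if "0 \<le> y" "0 \<le> z" for y z :: real
            using mult_le_weighted_squares[of "2^n" y z] that by (simp add: power_one_over)
          then show "norm (\<psi> x * (b x - r n x)) \<le> (1/2)^n * (norm (\<psi> x))\<^sup>2 + 2^n * (norm (b x - r n x))\<^sup>2" for x
            by (simp add: norm_mult)
        qed
        also have "\<dots> = (1/2)^n * (LINT x|M. (norm (\<psi> x))\<^sup>2) + 2^n * (LINT x|M. (norm (b x - r n x))\<^sup>2)"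
          using square_integrable_norm2[OF \<psi>] square_integrable_norm2[OF lim_diff(1)[of n]] by simp
        also have "\<dots> \<le> (1/2)^n * (LINT x|M. (norm (\<psi> x))\<^sup>2) + 2^n * (4 * (1/4)^n)"
          by (intro add_left_mono mult_left_mono lim_diff) auto
        also have "2^n * (4 * (1/4)^n) = 4 * (1/2::real)^n"
          using power_mult_distrib[of 2 "1/4::real" n] by simp
        finally show ?thesis by (simp add: algebra_simps)
      qed
      moreover have "(\<lambda>n. ((LINT x|M. (norm (\<psi> x))\<^sup>2) + 4) * (1/2::real)^n) \<longlonglongrightarrow> 0"
        by (intro tendsto_mult_right_zero LIMSEQ_realpow_zero) auto
      ultimately have "norm (LINT x|M. \<psi> x * b x) \<le> 0"
        by (intro LIMSEQ_le_const) auto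
      then show ?thesis by simp
    qed
    then show ?thesis using b_si by (simp add: V_def)
  qed
  have Db: "D b \<le> d"
  proof (rule field_le_epsilon)
    fix e :: real assume "0 < e"
    then obtain N where N: "(1/4::real)^N < e"
      using real_arch_pow_inv[of e "1/4"] by auto
    have le: "(LINT x|M. (norm (a x - r (n + N) x))\<^sup>2) \<le> d + e" for n
    proof -
      have "(1/4::real)^(n + N) \<le> (1/4)^N" by (intro power_decreasing) auto
      with N rD[of "n + N"] show ?thesis unfolding D_def by linarith
    qed
    have lim': "AE x in M. (\<lambda>n. a x - r (n + N) x) \<longlonglongrightarrow> a x - b x"
      using lim by eventually_elim (intro tendsto_intros LIMSEQ_ignore_initial_segment)
    show "D b \<le> d + e"
      unfolding D_def
      by (rule square_integrable_limit(2)[OF square_integrable_diff[OF a r_si] _ lim' le]) measurable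
  qed
  have "(LINT x|M. (a x - b x) * cnj (t x)) = 0" if t: "t \<in> V" for t
  proof -
    define e where "e x = a x - b x" for x
    define J where "J = (LINT x|M. e x * cnj (t x))"
    define R where "R = (LINT x|M. (norm (t x))\<^sup>2)"
    have e_si: "square_integrable M e" unfolding e_def by (intro square_integrable_diff a b_si)
    note t_si = V_si[OF t]
    have R: "0 \<le> R" by (simp add: R_def)
    \<comment> \<open>a step towards the projection of \<open>e\<close> on \<open>t\<close>; the summand 1 avoids a division by zero\<close>
    define l where "l = of_real (1 / (R + 1)) * J"
    have eq: "(norm (x - l * y))\<^sup>2 = (norm x)\<^sup>2 - 2 * Re (cnj l * (x * cnj y)) + (norm l)\<^sup>2 * (norm y)\<^sup>2"
      for x y :: complex
      unfolding cmod_power2 by (simp add: power2_eq_square algebra_simps)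
    have int: "integrable M (\<lambda>x. e x * cnj (t x))"
      by (intro integrable_mult_square_integrable e_si square_integrable_cnj t_si)
    have "D b \<le> D (\<lambda>x. 1 * b x + l * t x)"
      using Db d_le[OF V_lin[OF bV t]] by (rule order_trans)
    also have "\<dots> = (LINT x|M. (norm (e x))\<^sup>2 - 2 * Re (cnj l * (e x * cnj (t x))) + (norm l)\<^sup>2 * (norm (t x))\<^sup>2)"
      unfolding D_def eq[symmetric] by (simp add: e_def algebra_simps)
    also have "\<dots> = D b - 2 * Re (cnj l * J) + (norm l)\<^sup>2 * R"
    proof -
      have "integrable M (\<lambda>x. cnj l * (e x * cnj (t x)))" using int by simp
      then have "integrable M (\<lambda>x. Re (cnj l * (e x * cnj (t x))))"
          "(LINT x|M. Re (cnj l * (e x * cnj (t x)))) = Re (cnj l * J)"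
        by (simp_all only: integrable_Re integral_Re integral_mult_right_zero J_def)
      with square_integrable_norm2[OF e_si] square_integrable_norm2[OF t_si] show ?thesis
        by (simp add: D_def R_def e_def[symmetric] del: times_complex.sel complex_cnj_mult)
    qed
    finally have "2 * Re (cnj l * J) \<le> (norm l)\<^sup>2 * R" by simp
    moreover have "Re (cnj l * J) = (norm J)\<^sup>2 / (R + 1)"
    proof -
      have "cnj l * J = of_real (1 / (R + 1)) * (J * cnj J)" by (simp add: l_def)
      also have "\<dots> = of_real ((norm J)\<^sup>2 / (R + 1))"
        by (simp add: complex_mult_cnj cmod_power2)
      finally show ?thesis by (simp only: Re_complex_of_real)
    qed
    moreover have "(norm l)\<^sup>2 * R = (norm J)\<^sup>2 / (R + 1) * (R / (R + 1))"
    proof -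
      have "norm l = norm J / (R + 1)" using R by (simp add: l_def norm_mult norm_divide)
      then show ?thesis by (simp add: power2_eq_square)
    qed
    moreover have "(norm J)\<^sup>2 / (R + 1) * (R / (R + 1)) \<le> (norm J)\<^sup>2 / (R + 1) * 1"
      using R by (intro mult_left_mono) auto
    ultimately have "(norm J)\<^sup>2 / (R + 1) \<le> 0" by linarith
    then have "(norm J)\<^sup>2 \<le> 0" using R by (simp add: divide_le_0_iff)
    then show ?thesis by (simp add: J_def e_def)
  qed
  with bV that show ?thesis by blast
qed

section \<open>Arc length on the circle\<close>

interpretation circle: finite_measure circle_measure
proof
  have "emeasure circle_measure (space circle_measure) =
      emeasure (uniform_measure lborel {0..<2 * pi}) (space (uniform_measure lborel {0..<2 * pi}))"
    unfolding circle_measure_def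
  proof (subst emeasure_distr)
    have [measurable]: "cis \<in> borel_measurable borel"
      by (intro borel_measurable_continuous_onI continuous_intros)
    show "cis \<in> uniform_measure lborel {0..<2 * pi} \<rightarrow>\<^sub>M borel" by measurable
  qed auto
  also have "\<dots> \<le> 1" by simp
  finally show "emeasure circle_measure (space circle_measure) \<noteq> \<infinity>"
    by (auto simp: top_unique)
qed

lemma AE_circle_measure_iff:
  assumes [measurable]: "Measurable.pred borel P"
  shows "(AE \<zeta> in circle_measure. P \<zeta>) \<longleftrightarrow> (AE t in lborel. t \<in> {0..<2 * pi} \<longrightarrow> P (cis t))"
proof -
  have [measurable]: "cis \<in> borel_measurable borel"
    by (intro borel_measurable_continuous_onI continuous_intros)
  show ?thesis
    unfolding circle_measure_def
    by (subst AE_distr_iff) (auto simp: AE_uniform_measure)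
qed

lemma integral_circle_measure_const [simp]: "(LINT \<zeta>|circle_measure. c) = (c :: complex)"
proof -
  have "(LINT \<zeta>|circle_measure. c) = (LBINT t:{0..<2 * pi}. c) / (2 * pi)"
    by (rule integral_circle_measure) simp
  also have "\<dots> = c" by (simp add: set_integral_const scaleR_conv_of_real)
  finally show ?thesis .
qed

lemma integral_circle_measure_power: "(LINT \<zeta>|circle_measure. \<zeta> ^ Suc n) = 0"
proof -
  have deriv: "((\<lambda>t. cis (real (Suc n) * t) / (\<i> * of_nat (Suc n))) has_vector_derivative cis t ^ Suc n)
      (at t within {0..2 * pi})" for t
  proof -
    have "((\<lambda>t. cis (real (Suc n) * t)) has_vector_derivative (real (Suc n) *\<^sub>R (\<i> * cis (real (Suc n) * t))))
        (at t within {0..2 * pi})"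
      unfolding has_vector_derivative_def
      by (rule has_derivative_eq_rhs[OF has_derivative_cis[OF has_derivative_mult_right[OF has_derivative_ident]]])
        (simp add: fun_eq_iff)
    note has_vector_derivative_divide[OF this, of "\<i> * of_nat (Suc n)"]
    moreover have "(real (Suc n) *\<^sub>R (\<i> * cis (real (Suc n) * t))) / (\<i> * of_nat (Suc n)) = cis t ^ Suc n"
      by (subst Complex.DeMoivre) (simp add: scaleR_conv_of_real del: of_nat_Suc)
    ultimately show ?thesis by simp
  qed
  have "integral\<^sup>L circle_measure (\<lambda>\<zeta>. \<zeta> ^ Suc n) = (LBINT t:{0..<2 * pi}. cis t ^ Suc n) / (2 * pi)"
    by (rule integral_circle_measure) simp
  also have "(LBINT t:{0..<2 * pi}. cis t ^ Suc n) = (LBINT t:{0..2 * pi}. cis t ^ Suc n)"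
  proof -
    have *: "AE t in lborel. t \<noteq> 2 * pi" by (rule AE_lborel_singleton)
    have [measurable]: "cis \<in> borel_measurable borel"
      by (intro borel_measurable_continuous_onI continuous_intros)
    show ?thesis
      unfolding set_lebesgue_integral_def
      by (intro integral_cong_AE) (measurable, use * in eventually_elim, auto simp: indicator_def)
  qed
  also have "\<dots> = 0"
  proof -
    have "integral\<^sup>L lborel (\<lambda>t. indicator {0..2 * pi} t *\<^sub>R cis t ^ Suc n) =
      cis (real (Suc n) * (2 * pi)) / (\<i> * of_nat (Suc n)) - cis (real (Suc n) * 0) / (\<i> * of_nat (Suc n))"
      by (intro integral_FTC_atLeastAtMost deriv continuous_intros) auto
    also have "cis (real (Suc n) * (2 * pi)) = 1"
      using cis_multiple_2pi[of "real (Suc n)"] by (simp add: mult_ac)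
    finally show ?thesis by (simp add: set_lebesgue_integral_def)
  qed
  finally show ?thesis by simp
qed

lemma AE_circle_measure_neq: "AE \<zeta> in circle_measure. \<zeta> \<noteq> z"
proof (subst AE_circle_measure_iff)
  have "countable {t. cis t = z}"
  proof (cases "\<exists>s. cis s = z")
    case True
    then obtain s where s: "cis s = z" by blast
    have "{t. cis t = z} \<subseteq> (\<lambda>n::int. s + 2 * pi * n) ` UNIV"
    proof
      fix t assume "t \<in> {t. cis t = z}"
      then have "sin t = sin s \<and> cos t = cos s" using s by (auto simp: complex_eq_iff)
      then show "t \<in> (\<lambda>n::int. s + 2 * pi * n) ` UNIV"
        by (auto simp: sin_cos_eq_iff)
    qed
    then show ?thesis by (rule countable_subset) auto
  qed auto
  then have "AE t in lborel. t \<notin> {t. cis t = z}"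
    by (intro AE_not_in countable_imp_null_set_lborel)
  then show "AE t in lborel. t \<in> {0..<2 * pi} \<longrightarrow> cis t \<noteq> z" by eventually_elim auto
qed simp

text \<open>Every nonempty open arc has positive length.\<close>

lemma continuous_AE_circle_eq_0:
  fixes \<phi> :: "complex \<Rightarrow> real"
  assumes cont: "continuous_on UNIV \<phi>" and AE: "AE \<zeta> in circle_measure. \<phi> \<zeta> = 0" and z: "norm z = 1"
  shows "\<phi> z = 0"
proof (rule ccontr)
  assume nz: "\<phi> z \<noteq> 0"
  have [measurable]: "\<phi> \<in> borel_measurable borel" by (rule borel_measurable_continuous_onI[OF cont])
  obtain s where s: "0 \<le> s" "s < 2 * pi" "z = cis s"
    using complex_unimodular_polar[OF z] by (auto simp: cis.code)
  have "continuous_on UNIV (\<lambda>t. \<phi> (cis t))"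
    by (rule continuous_on_compose2[OF cont]) (auto intro!: continuous_intros)
  then have "open ((\<lambda>t. \<phi> (cis t)) -` (- {0}))"
    by (intro open_vimage) auto
  moreover have "s \<in> (\<lambda>t. \<phi> (cis t)) -` (- {0})" using nz s by simp
  ultimately obtain e where e: "0 < e" "\<And>t. dist t s < e \<Longrightarrow> \<phi> (cis t) \<noteq> 0"
    by (metis (no_types, lifting) open_dist vimage_eq ComplD insertI1)
  define m where "m = min (s + e) (2 * pi)"
  have "AE t in lborel. t \<in> {0..<2 * pi} \<longrightarrow> \<phi> (cis t) = 0"
    using AE by (subst (asm) AE_circle_measure_iff) auto
  then have "AE t in lborel. t \<notin> {s<..<m}"
  proof eventually_elim
    case (elim t)
    then show ?case using e(2)[of t] s by (auto simp: m_def dist_real_def)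
  qed
  then have "{s<..<m} \<in> null_sets lborel"
    by (subst AE_iff_null_sets) auto
  then have "emeasure lborel {s<..<m} = 0" by (rule null_setsD1)
  moreover have "s < m" using e s by (simp add: m_def)
  ultimately show False by simp
qed

lemma integrable_mult_bounded:
  fixes h F :: "'a \<Rightarrow> complex"
  assumes [measurable]: "h \<in> borel_measurable M" and F: "integrable M F"
    and "AE x in M. norm (h x) \<le> C"
  shows "integrable M (\<lambda>x. h x * F x)"
proof (rule Bochner_Integration.integrable_bound)
  show "integrable M (\<lambda>x. C * norm (F x))" using F by simp
  show "(\<lambda>x. h x * F x) \<in> borel_measurable M"
    using borel_measurable_integrable[OF F] by measurable
  show "AE x in M. norm (h x * F x) \<le> norm (C * norm (F x))"
    using assms(3)
  proof eventually_elim
    case (elim x)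
    then have "norm (h x) * norm (F x) \<le> C * norm (F x)" by (intro mult_right_mono) auto
    then show ?case by (simp add: norm_mult)
  qed
qed

lemma integrable_power_mult:
  assumes "integrable circle_measure F"
  shows "integrable circle_measure (\<lambda>\<zeta>. \<zeta> ^ n * F \<zeta>)"
proof (rule integrable_mult_bounded[OF _ assms])
  show "AE \<zeta> in circle_measure. norm (\<zeta> ^ n) \<le> 1"
    using AE_circle_measure_norm by eventually_elim (simp add: norm_power)
qed measurable

lemma integrable_cnj_power_mult:
  assumes "integrable circle_measure F"
  shows "integrable circle_measure (\<lambda>\<zeta>. cnj \<zeta> ^ n * F \<zeta>)"
proof (rule integrable_mult_bounded[OF _ assms])
  show "AE \<zeta> in circle_measure. norm (cnj \<zeta> ^ n) \<le> 1"
    using AE_circle_measure_norm by eventually_elim (simp add: norm_power)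
qed measurable

lemma AE_circle_measure_mult_cnj: "AE \<zeta> in circle_measure. \<zeta> * cnj \<zeta> = 1"
  using AE_circle_measure_norm
  by eventually_elim (metis complex_norm_square of_real_1 power_one)

section \<open>Uniqueness of Fourier coefficients\<close>

definition zero_coefficients :: "(complex \<Rightarrow> complex) \<Rightarrow> bool" where
  "zero_coefficients F \<longleftrightarrow> integrable circle_measure F \<and>
    (\<forall>n. (LINT \<zeta>|circle_measure. \<zeta> ^ n * F \<zeta>) = 0) \<and>
    (\<forall>n. (LINT \<zeta>|circle_measure. cnj \<zeta> ^ n * F \<zeta>) = 0)"

lemma zero_coefficients_lincomb:
  assumes "zero_coefficients F" "zero_coefficients G"
  shows "zero_coefficients (\<lambda>\<zeta>. a * F \<zeta> + b * G \<zeta>)"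
proof -
  have "(LINT \<zeta>|circle_measure. h \<zeta> * (a * F \<zeta> + b * G \<zeta>)) = 
     a * (LINT \<zeta>|circle_measure. h \<zeta> * F \<zeta>) + b * (LINT \<zeta>|circle_measure. h \<zeta> * G \<zeta>)"
    if "integrable circle_measure (\<lambda>\<zeta>. h \<zeta> * F \<zeta>)" "integrable circle_measure (\<lambda>\<zeta>. h \<zeta> * G \<zeta>)" for h
  proof -
    have "h \<zeta> * (a * F \<zeta> + b * G \<zeta>) = a * (h \<zeta> * F \<zeta>) + b * (h \<zeta> * G \<zeta>)" for \<zeta>
      by (simp add: algebra_simps)
    then show ?thesis using that by simp
  qed
  note lincomb = this
  have F: "integrable circle_measure F" and G: "integrable circle_measure G"
    using assms by (simp_all add: zero_coefficients_def)
  show ?thesis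
    unfolding zero_coefficients_def
  proof (intro conjI allI)
    show "integrable circle_measure (\<lambda>\<zeta>. a * F \<zeta> + b * G \<zeta>)" using F G by simp
    show "(LINT \<zeta>|circle_measure. \<zeta> ^ n * (a * F \<zeta> + b * G \<zeta>)) = 0" for n
      using lincomb[OF integrable_power_mult[OF F] integrable_power_mult[OF G], of n] assms
      by (simp only: zero_coefficients_def mult_zero_right add_0)
    show "(LINT \<zeta>|circle_measure. cnj \<zeta> ^ n * (a * F \<zeta> + b * G \<zeta>)) = 0" for n
      using lincomb[OF integrable_cnj_power_mult[OF F] integrable_cnj_power_mult[OF G], of n] assms
      by (simp only: zero_coefficients_def mult_zero_right add_0)
  qed
qed

lemma zero_coefficients_mult_id:
  assumes "zero_coefficients F"
  shows "zero_coefficients (\<lambda>\<zeta>. \<zeta> * F \<zeta>)" "zero_coefficients (\<lambda>\<zeta>. cnj \<zeta> * F \<zeta>)"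
proof -
  have F: "integrable circle_measure F" using assms by (simp add: zero_coefficients_def)
  note [measurable] = borel_measurable_integrable[OF F]
  have 1: "(LINT \<zeta>|circle_measure. cnj \<zeta> ^ Suc n * (\<zeta> * F \<zeta>)) = (LINT \<zeta>|circle_measure. cnj \<zeta> ^ n * F \<zeta>)" for n
  proof (rule integral_cong_AE)
    show "AE \<zeta> in circle_measure. cnj \<zeta> ^ Suc n * (\<zeta> * F \<zeta>) = cnj \<zeta> ^ n * F \<zeta>"
      using AE_circle_measure_mult_cnj
    proof eventually_elim
      case (elim \<zeta>)
      have "cnj \<zeta> ^ Suc n * (\<zeta> * F \<zeta>) = cnj \<zeta> ^ n * F \<zeta> * (\<zeta> * cnj \<zeta>)"
        by (simp only: power_Suc mult_ac)
      then show ?case using elim by simp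
    qed
  qed measurable
  have 2: "(LINT \<zeta>|circle_measure. \<zeta> ^ Suc n * (cnj \<zeta> * F \<zeta>)) = (LINT \<zeta>|circle_measure. \<zeta> ^ n * F \<zeta>)" for n
  proof (rule integral_cong_AE)
    show "AE \<zeta> in circle_measure. \<zeta> ^ Suc n * (cnj \<zeta> * F \<zeta>) = \<zeta> ^ n * F \<zeta>"
      using AE_circle_measure_mult_cnj
    proof eventually_elim
      case (elim \<zeta>)
      have "\<zeta> ^ Suc n * (cnj \<zeta> * F \<zeta>) = \<zeta> ^ n * F \<zeta> * (\<zeta> * cnj \<zeta>)"
        by (simp only: power_Suc mult_ac)
      then show ?case using elim by simp
    qed
  qed measurable
  have 3: "(LINT \<zeta>|circle_measure. \<zeta> ^ n * (\<zeta> * F \<zeta>)) = 0" "(LINT \<zeta>|circle_measure. cnj \<zeta> ^ n * (cnj \<zeta> * F \<zeta>)) = 0" for n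
  proof -
    have "(LINT \<zeta>|circle_measure. \<zeta> ^ Suc n * F \<zeta>) = 0" "(LINT \<zeta>|circle_measure. cnj \<zeta> ^ Suc n * F \<zeta>) = 0"
      using assms unfolding zero_coefficients_def by blast+
    then show "(LINT \<zeta>|circle_measure. \<zeta> ^ n * (\<zeta> * F \<zeta>)) = 0"
        "(LINT \<zeta>|circle_measure. cnj \<zeta> ^ n * (cnj \<zeta> * F \<zeta>)) = 0"
      by (simp_all only: power_Suc mult_ac)
  qed
  show "zero_coefficients (\<lambda>\<zeta>. \<zeta> * F \<zeta>)"
    unfolding zero_coefficients_def
  proof (intro conjI allI 3)
    show "integrable circle_measure (\<lambda>\<zeta>. \<zeta> * F \<zeta>)" using integrable_power_mult[OF F, of 1] by simp
    show "(LINT \<zeta>|circle_measure. cnj \<zeta> ^ n * (\<zeta> * F \<zeta>)) = 0" for n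
      using 1 3(1)[of 0] assms by (cases n) (simp_all add: zero_coefficients_def)
  qed
  show "zero_coefficients (\<lambda>\<zeta>. cnj \<zeta> * F \<zeta>)"
    unfolding zero_coefficients_def
  proof (intro conjI allI 3)
    show "integrable circle_measure (\<lambda>\<zeta>. cnj \<zeta> * F \<zeta>)" using integrable_cnj_power_mult[OF F, of 1] by simp
    show "(LINT \<zeta>|circle_measure. \<zeta> ^ n * (cnj \<zeta> * F \<zeta>)) = 0" for n
      using 2 3(2)[of 0] assms by (cases n) (simp_all add: zero_coefficients_def)
  qed
qed

text \<open>The functions with vanishing coefficients are stable under multiplication by the coordinate and its
  conjugate, hence by all real polynomials of the plane. Stability, as opposed to a vanishing
  integral, is what passes through products in the induction.\<close>

lemma zero_coefficients_mult_polynomial: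
  assumes "real_polynomial_function g" "zero_coefficients F"
  shows "zero_coefficients (\<lambda>\<zeta>. of_real (g \<zeta>) * F \<zeta>)"
  using assms
proof (induction arbitrary: F rule: real_polynomial_function.induct)
  case (linear g)
  define a b where "a = Complex (g 1 / 2) (- g \<i> / 2)" and "b = Complex (g 1 / 2) (g \<i> / 2)"
  have gz: "g z = Re z * g 1 + Im z * g \<i>" for z
  proof -
    have "z = Re z *\<^sub>R 1 + Im z *\<^sub>R \<i>" by (simp add: complex_eq_iff)
    then have "g z = g (Re z *\<^sub>R 1 + Im z *\<^sub>R \<i>)" by simp
    also have "\<dots> = Re z * g 1 + Im z * g \<i>"
      using bounded_linear.linear[OF linear(1)]
      by (simp only: linear_add linear_scale real_scaleR_def)
    finally show ?thesis .
  qed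
  have "of_real (g z) = a * z + b * cnj z" for z
    using gz[of z] by (simp add: complex_eq_iff a_def b_def field_simps)
  then have "(\<lambda>\<zeta>. of_real (g \<zeta>) * F \<zeta>) = (\<lambda>\<zeta>. a * (\<zeta> * F \<zeta>) + b * (cnj \<zeta> * F \<zeta>))"
    by (auto simp: algebra_simps)
  then show ?case
    using zero_coefficients_lincomb[OF zero_coefficients_mult_id[OF linear(2)], of a b] by simp
next
  case (const c)
  then show ?case using zero_coefficients_lincomb[OF const const, of "of_real c" 0]
    by (simp only: mult_zero_left add_0_right)
next
  case (add f g)
  from zero_coefficients_lincomb[OF add.IH[OF add.prems], of 1 1]
  show ?case by (simp only: of_real_add distrib_right mult_1_left)
next
  case (mult f g)
  from mult.IH(1)[OF mult.IH(2)[OF mult.prems]]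
  show ?case by (simp only: of_real_mult mult.assoc)
qed

text \<open>Uniform approximation of the continuous function by polynomials on the circle.\<close>

lemma zero_coefficients_continuous:
  fixes \<phi> :: "complex \<Rightarrow> real"
  assumes F: "zero_coefficients F" and \<phi>: "continuous_on UNIV \<phi>"
  shows "(LINT \<zeta>|circle_measure. of_real (\<phi> \<zeta>) * F \<zeta>) = 0"
proof -
  define N where "N = (LINT \<zeta>|circle_measure. norm (F \<zeta>))"
  have N: "0 \<le> N" by (simp add: N_def)
  have Fi: "integrable circle_measure F" using F by (simp add: zero_coefficients_def)
  have [measurable]: "\<phi> \<in> borel_measurable borel" by (rule borel_measurable_continuous_onI[OF \<phi>])
  have "norm (LINT \<zeta>|circle_measure. of_real (\<phi> \<zeta>) * F \<zeta>) \<le> e * N" if e: "0 < e" for e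
  proof -
    have "continuous_on (sphere 0 1) \<phi>" using \<phi> by (rule continuous_on_subset) auto
    then obtain g where g: "polynomial_function g" "\<And>\<zeta>. \<zeta> \<in> sphere 0 1 \<Longrightarrow> norm (\<phi> \<zeta> - g \<zeta>) < e"
      using Stone_Weierstrass_polynomial_function[OF compact_sphere _ e] by metis
    then have "real_polynomial_function g" by (simp add: real_polynomial_function_eq)
    note zg = zero_coefficients_mult_polynomial[OF this F]
    have [measurable]: "g \<in> borel_measurable borel"
      using g(1) by (intro borel_measurable_continuous_onI continuous_on_polymonial_function)
    have AE: "AE \<zeta> in circle_measure. norm (complex_of_real (\<phi> \<zeta> - g \<zeta>)) \<le> e"
      using AE_circle_measure_norm by eventually_elim (use g(2) in \<open>force intro: less_imp_le simp del: of_real_diff\<close>)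
    have int: "integrable circle_measure (\<lambda>\<zeta>. of_real (\<phi> \<zeta> - g \<zeta>) * F \<zeta>)"
      by (rule integrable_mult_bounded[OF _ Fi AE]) measurable
    have intg: "integrable circle_measure (\<lambda>\<zeta>. of_real (g \<zeta>) * F \<zeta>)"
      using zg by (simp add: zero_coefficients_def)
    have "(LINT \<zeta>|circle_measure. of_real (g \<zeta>) * F \<zeta>) = 0"
      using zg unfolding zero_coefficients_def by (metis (no_types, lifting) mult_1 power_0 Bochner_Integration.integral_cong)
    moreover have "(LINT \<zeta>|circle_measure. of_real (\<phi> \<zeta>) * F \<zeta>) =
        (LINT \<zeta>|circle_measure. of_real (\<phi> \<zeta> - g \<zeta>) * F \<zeta> + of_real (g \<zeta>) * F \<zeta>)"
      by (simp add: algebra_simps)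
    ultimately have "(LINT \<zeta>|circle_measure. of_real (\<phi> \<zeta>) * F \<zeta>) = (LINT \<zeta>|circle_measure. of_real (\<phi> \<zeta> - g \<zeta>) * F \<zeta>)"
      using int intg by (simp del: of_real_diff)
    also have "norm \<dots> \<le> (LINT \<zeta>|circle_measure. norm (of_real (\<phi> \<zeta> - g \<zeta>) * F \<zeta>))"
      by (rule integral_norm_bound)
    also have "\<dots> \<le> (LINT \<zeta>|circle_measure. e * norm (F \<zeta>))"
    proof (rule integral_mono_AE)
      show "AE \<zeta> in circle_measure. norm (of_real (\<phi> \<zeta> - g \<zeta>) * F \<zeta>) \<le> e * norm (F \<zeta>)"
        using AE by eventually_elim (simp add: norm_mult mult_right_mono del: of_real_diff)
    qed (use int Fi in auto)
    finally show ?thesis by (simp add: N_def)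
  qed
  from this[of "e / (N + 1)" for e]
  have "norm (LINT \<zeta>|circle_measure. of_real (\<phi> \<zeta>) * F \<zeta>) \<le> 0 + e" if "0 < e" for e
  proof -
    have "norm (LINT \<zeta>|circle_measure. of_real (\<phi> \<zeta>) * F \<zeta>) \<le> e / (N + 1) * N"
      using that N by (intro \<open>\<And>e. 0 < e / (N + 1) \<Longrightarrow> _\<close>) auto
    also have "\<dots> \<le> e" using that N by (simp add: field_simps)
    finally show ?thesis by simp
  qed
  then have "norm (LINT \<zeta>|circle_measure. of_real (\<phi> \<zeta>) * F \<zeta>) \<le> 0" by (rule field_le_epsilon)
  then show ?thesis by simp
qed

text \<open>The indicator function is the pointwise limit of continuous functions of the distance to the set.\<close>

lemma zero_coefficients_closed:
  assumes F: "zero_coefficients F" and C: "closed C"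
  shows "(LINT \<zeta>|circle_measure. indicator C \<zeta> * F \<zeta>) = 0"
proof (cases "C = {}")
  case False
  have Fi: "integrable circle_measure F" using F by (simp add: zero_coefficients_def)
  note [measurable] = borel_measurable_integrable[OF Fi]
  define \<phi> where "\<phi> n \<zeta> = max 0 (1 - real n * infdist \<zeta> C)" for n \<zeta>
  have cont: "continuous_on UNIV (\<phi> n)" for n
    unfolding \<phi>_def by (intro continuous_intros)
  have [measurable]: "\<phi> n \<in> borel_measurable borel" for n by (rule borel_measurable_continuous_onI[OF cont])
  have [measurable]: "C \<in> sets borel" using C by simp
  have \<phi>_le: "\<bar>\<phi> n \<zeta>\<bar> \<le> 1" for n \<zeta> by (auto simp: \<phi>_def infdist_nonneg)
  have \<phi>_lim: "(\<lambda>n. \<phi> n \<zeta>) \<longlonglongrightarrow> indicator C \<zeta>" for \<zeta>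
  proof (cases "\<zeta> \<in> C")
    case True
    then show ?thesis by (simp add: \<phi>_def)
  next
    case notin: False
    then have "0 < infdist \<zeta> C"
      using C False in_closed_iff_infdist_zero infdist_nonneg by (metis less_eq_real_def)
    then obtain N where N: "1 < real N * infdist \<zeta> C" using reals_Archimedean3 by blast
    have "\<phi> n \<zeta> = 0" if "N \<le> n" for n
    proof -
      have "real N * infdist \<zeta> C \<le> real n * infdist \<zeta> C"
        using that by (intro mult_right_mono) (auto simp: infdist_nonneg)
      then show ?thesis using N by (simp add: \<phi>_def)
    qed
    then have "eventually (\<lambda>n. \<phi> n \<zeta> = 0) sequentially" by (auto simp: eventually_sequentially)
    then show ?thesis using notin by (simp add: tendsto_eventually)
  qed
  have "(\<lambda>n. LINT \<zeta>|circle_measure. of_real (\<phi> n \<zeta>) * F \<zeta>) \<longlonglongrightarrow> (LINT \<zeta>|circle_measure. of_real (indicator C \<zeta>) * F \<zeta>)"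
  proof (rule integral_dominated_convergence)
    show "integrable circle_measure (\<lambda>\<zeta>. norm (F \<zeta>))" using Fi by simp
    show "AE \<zeta> in circle_measure. (\<lambda>n. of_real (\<phi> n \<zeta>) * F \<zeta>) \<longlonglongrightarrow> of_real (indicator C \<zeta>) * F \<zeta>"
      by (intro AE_I2 tendsto_intros \<phi>_lim)
    show "AE \<zeta> in circle_measure. norm (of_real (\<phi> n \<zeta>) * F \<zeta>) \<le> norm (F \<zeta>)" for n
      using \<phi>_le by (intro AE_I2) (simp add: norm_mult mult_left_le_one_le)
  qed measurable
  then have "(LINT \<zeta>|circle_measure. of_real (indicator C \<zeta>) * F \<zeta>) = 0"
    by (simp add: zero_coefficients_continuous[OF F cont] LIMSEQ_const_iff)
  moreover have "complex_of_real (indicator C \<zeta>) = indicator C \<zeta>" for \<zeta> by (simp add: indicator_def)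
  ultimately show ?thesis by simp
qed auto

text \<open>The closed sets generate the Borel sets and are stable under intersections, so the integral over
  every Borel set vanishes, in particular over the sets where the real or the imaginary part has a
  given sign.\<close>

theorem zero_coefficients_imp_AE_eq_0:
  assumes F: "zero_coefficients F"
  shows "AE \<zeta> in circle_measure. F \<zeta> = 0"
proof -
  have Fi: "integrable circle_measure F" using F by (simp add: zero_coefficients_def)
  note [measurable] = borel_measurable_integrable[OF Fi]
  have int: "integrable circle_measure (\<lambda>\<zeta>. indicator A \<zeta> * F \<zeta>)" if "A \<in> sets borel" for A
    using that by (intro integrable_mult_bounded[where C = 1] Fi) (auto simp: indicator_def)
  have zero: "(LINT \<zeta>|circle_measure. indicator A \<zeta> * F \<zeta>) = 0" if "A \<in> sets borel" for A
  proof -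
    have "Int_stable (Collect closed :: complex set set)" by (auto simp: Int_stable_def)
    moreover have "Collect closed \<subseteq> Pow (UNIV :: complex set)" by simp
    moreover have "A \<in> sigma_sets UNIV (Collect closed)" using that by (simp add: borel_eq_closed)
    ultimately show ?thesis
    proof (induction rule: sigma_sets_induct_disjoint)
      case (basic C)
      then show ?case using zero_coefficients_closed[OF F] by simp
    next
      case empty
      show ?case by simp
    next
      case (compl A)
      then have A [measurable]: "A \<in> sets borel" by (simp add: borel_eq_closed)
      have "(LINT \<zeta>|circle_measure. indicator (UNIV - A) \<zeta> * F \<zeta>) =
          (LINT \<zeta>|circle_measure. indicator UNIV \<zeta> * F \<zeta> - indicator A \<zeta> * F \<zeta>)"
        by (intro Bochner_Integration.integral_cong) (auto simp: indicator_def)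
      also have "\<dots> = 0"
        using int[OF A] int[of UNIV] compl.IH zero_coefficients_closed[OF F closed_UNIV] by simp
      finally show ?case .
    next
      case (union A)
      then have [measurable]: "A i \<in> sets borel" for i by (auto simp: borel_eq_closed)
      have "(\<lambda>n. LINT \<zeta>|circle_measure. (\<Sum>i<n. indicator (A i) \<zeta> * F \<zeta>)) \<longlonglongrightarrow>
          (LINT \<zeta>|circle_measure. indicator (\<Union>i. A i) \<zeta> * F \<zeta>)"
      proof (rule integral_dominated_convergence)
        show "integrable circle_measure (\<lambda>\<zeta>. norm (F \<zeta>))" using Fi by simp
        have eq: "(\<Sum>i<n. indicator (A i) \<zeta> * F \<zeta>) = indicator (\<Union>i<n. A i) \<zeta> * F \<zeta>" for n \<zeta>
        proof -
          have "disjoint_family_on A {..<n}" using union(1) by (rule disjoint_family_on_mono[rotated]) auto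
          then show ?thesis by (simp add: indicator_UN_disjoint sum_distrib_right)
        qed
        show "AE \<zeta> in circle_measure. (\<lambda>n. \<Sum>i<n. indicator (A i) \<zeta> * F \<zeta>) \<longlonglongrightarrow> indicator (\<Union>i. A i) \<zeta> * F \<zeta>"
          unfolding eq by (intro AE_I2 tendsto_intros LIMSEQ_indicator_UN)
        show "AE \<zeta> in circle_measure. norm (\<Sum>i<n. indicator (A i) \<zeta> * F \<zeta>) \<le> norm (F \<zeta>)" for n
          unfolding eq by (intro AE_I2) (auto simp: indicator_def)
      qed measurable
      moreover have "(LINT \<zeta>|circle_measure. (\<Sum>i<n. indicator (A i) \<zeta> * F \<zeta>)) = 0" for n
        using union(3) by (subst Bochner_Integration.integral_sum) (auto intro!: int)
      ultimately show ?case by (simp only: LIMSEQ_const_iff)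
    qed
  qed
  have nonpos: "AE \<zeta> in circle_measure. L (F \<zeta>) \<le> 0" if L: "bounded_linear L" for L :: "complex \<Rightarrow> real"
  proof -
    have [measurable]: "L \<in> borel_measurable borel"
      by (intro borel_measurable_continuous_onI linear_continuous_on L)
    define A where "A = {\<zeta>. 0 < L (F \<zeta>)}"
    have A: "A \<in> sets borel"
    proof -
      have "{\<zeta> \<in> space circle_measure. 0 < L (F \<zeta>)} \<in> sets circle_measure" by measurable
      then show ?thesis by (simp add: A_def space_borel sets_eq_imp_space_eq[OF sets_circle_measure])
    qed
    have eq: "L (indicator A \<zeta> * F \<zeta>) = max 0 (L (F \<zeta>))" for \<zeta>
      using linear_0[OF bounded_linear.linear[OF L]] by (auto simp: A_def indicator_def)
    have "(LINT \<zeta>|circle_measure. max 0 (L (F \<zeta>))) = L (LINT \<zeta>|circle_measure. indicator A \<zeta> * F \<zeta>)"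
      unfolding eq[symmetric] by (rule integral_bounded_linear[OF L int[OF A]])
    also have "\<dots> = 0" using zero[OF A] linear_0[OF bounded_linear.linear[OF L]] by simp
    finally have "(LINT \<zeta>|circle_measure. max 0 (L (F \<zeta>))) = 0" .
    moreover have "integrable circle_measure (\<lambda>\<zeta>. max 0 (L (F \<zeta>)))"
      unfolding eq[symmetric] by (rule integrable_bounded_linear[OF L int[OF A]])
    ultimately have "AE \<zeta> in circle_measure. max 0 (L (F \<zeta>)) = 0"
      by (subst (asm) integral_nonneg_eq_0_iff_AE) auto
    then show ?thesis by eventually_elim (auto simp: max_def split: if_splits)
  qed
  show ?thesis
    using nonpos[OF bounded_linear_Re] nonpos[OF bounded_linear_minus[OF bounded_linear_Re]]
      nonpos[OF bounded_linear_Im] nonpos[OF bounded_linear_minus[OF bounded_linear_Im]]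
    by eventually_elim (auto simp: complex_eq_iff)
qed

section \<open>Hardy classes\<close>

text \<open>On the circle \<open>\<zeta>\<close> is the inverse of \<open>cnj \<zeta>\<close>, so these integrals are the Fourier coefficients with
  negative index.\<close>

definition H1_function :: "(complex \<Rightarrow> complex) \<Rightarrow> bool" where
  "H1_function F \<longleftrightarrow> integrable circle_measure F \<and>
    (\<forall>n. (LINT \<zeta>|circle_measure. \<zeta> ^ Suc n * F \<zeta>) = 0)"

definition H2_function :: "(complex \<Rightarrow> complex) \<Rightarrow> bool" where
  "H2_function F \<longleftrightarrow> square_integrable circle_measure F \<and> H1_function F"

lemma H1_function_integrable: "H1_function F \<Longrightarrow> integrable circle_measure F"
  by (simp add: H1_function_def)

lemma H1_function_measurable [measurable_dest]:
  "H1_function F \<Longrightarrow> F \<in> borel_measurable circle_measure"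
  by (rule borel_measurable_integrable) (rule H1_function_integrable)

lemma measure_space_circle_measure [simp]: "measure circle_measure (space circle_measure) = 1"
  using integral_circle_measure_const[of 1] by (simp add: scaleR_conv_of_real)

lemma H1_function_integral: "H1_function F \<Longrightarrow> (LINT \<zeta>|circle_measure. \<zeta> ^ Suc n * F \<zeta>) = 0"
  unfolding H1_function_def by blast

lemma H1_function_cong_AE:
  assumes F: "H1_function F" and [measurable]: "G \<in> borel_measurable circle_measure"
    and eq: "AE \<zeta> in circle_measure. F \<zeta> = G \<zeta>"
  shows "H1_function G"
proof -
  note [measurable] = H1_function_measurable[OF F]
  have "integrable circle_measure F \<longleftrightarrow> integrable circle_measure G"
    by (rule integrable_cong_AE) (use eq in auto)
  moreover have "(LINT \<zeta>|circle_measure. \<zeta> ^ Suc n * F \<zeta>) = (LINT \<zeta>|circle_measure. \<zeta> ^ Suc n * G \<zeta>)" for n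
    by (rule integral_cong_AE) (measurable, use eq in eventually_elim, simp)
  ultimately show ?thesis using F by (simp add: H1_function_def del: power_Suc)
qed

lemma H1_function_lincomb:
  assumes "H1_function F" "H1_function G"
  shows "H1_function (\<lambda>\<zeta>. a * F \<zeta> + b * G \<zeta>)"
proof -
  have F: "integrable circle_measure F" and G: "integrable circle_measure G"
    using assms by (simp_all add: H1_function_integrable)
  have "(LINT \<zeta>|circle_measure. \<zeta> ^ Suc n * (a * F \<zeta> + b * G \<zeta>)) = 0" for n
  proof -
    have "\<zeta> ^ Suc n * (a * F \<zeta> + b * G \<zeta>) = a * (\<zeta> ^ Suc n * F \<zeta>) + b * (\<zeta> ^ Suc n * G \<zeta>)" for \<zeta>
      by (simp only: distrib_left mult.left_commute)
    then have "(LINT \<zeta>|circle_measure. \<zeta> ^ Suc n * (a * F \<zeta> + b * G \<zeta>)) =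
        a * (LINT \<zeta>|circle_measure. \<zeta> ^ Suc n * F \<zeta>) + b * (LINT \<zeta>|circle_measure. \<zeta> ^ Suc n * G \<zeta>)"
      using integrable_power_mult[OF F, of "Suc n"] integrable_power_mult[OF G, of "Suc n"]
      by (simp del: power_Suc)
    then show ?thesis
      by (simp only: H1_function_integral[OF assms(1)] H1_function_integral[OF assms(2)] mult_zero_right add_0)
  qed
  then show ?thesis using F G by (simp add: H1_function_def)
qed

lemma H1_function_cmult: "H1_function F \<Longrightarrow> H1_function (\<lambda>\<zeta>. a * F \<zeta>)"
  using H1_function_lincomb[of F F a 0] by simp

lemma H1_function_const: "H1_function (\<lambda>_. c)"
proof -
  have "(LINT \<zeta>|circle_measure. \<zeta> ^ Suc n * c) = 0" for n
    using integral_circle_measure_power[of n] by simp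
  then show ?thesis by (simp add: H1_function_def)
qed

lemma H1_function_mult_power:
  assumes "H1_function F"
  shows "H1_function (\<lambda>\<zeta>. \<zeta> ^ n * F \<zeta>)"
proof -
  have "\<zeta> ^ Suc m * (\<zeta> ^ n * F \<zeta>) = \<zeta> ^ Suc (m + n) * F \<zeta>" for m \<zeta>
    by (simp add: power_add mult_ac)
  then have "(LINT \<zeta>|circle_measure. \<zeta> ^ Suc m * (\<zeta> ^ n * F \<zeta>)) = 0" for m
    by (simp only: H1_function_integral[OF assms])
  then show ?thesis
    using integrable_power_mult[OF H1_function_integrable[OF assms]] by (simp add: H1_function_def del: power_Suc)
qed

lemma H1_function_mult_poly:
  assumes "H1_function F"
  shows "H1_function (\<lambda>\<zeta>. poly p \<zeta> * F \<zeta>)"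
proof (induction p)
  case 0
  then show ?case using H1_function_const[of 0] by simp
next
  case (pCons a p)
  from H1_function_lincomb[OF assms H1_function_mult_power[OF pCons(2), of 1], of a 1]
  show ?case by (simp add: algebra_simps)
qed

lemma H1_function_poly: "H1_function (poly p)"
  using H1_function_mult_poly[OF H1_function_const[of 1]] by simp

lemma H2_functionI:
  assumes "H1_function F" "square_integrable circle_measure F"
  shows "H2_function F"
  using assms by (simp add: H2_function_def)

lemma H1_function_zero_if:
  assumes "H1_function F" "\<And>n. (LINT \<zeta>|circle_measure. cnj \<zeta> ^ n * F \<zeta>) = 0"
  shows "AE \<zeta> in circle_measure. F \<zeta> = 0"
proof (rule zero_coefficients_imp_AE_eq_0)
  have "(LINT \<zeta>|circle_measure. \<zeta> ^ n * F \<zeta>) = 0" for n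
    using H1_function_integral[OF assms(1)] assms(2)[of 0] by (cases n) simp_all
  then show "zero_coefficients F"
    using assms H1_function_integrable by (simp add: zero_coefficients_def)
qed

text \<open>A function that is analytic and conjugate analytic has no frequency other than zero.\<close>

lemma AE_constant_if_coefficients_zero:
  assumes F: "H1_function F" and cnj: "H1_function (\<lambda>\<zeta>. cnj (F \<zeta>))"
  shows "AE \<zeta> in circle_measure. F \<zeta> = (LINT \<zeta>|circle_measure. F \<zeta>)"
proof -
  define c where "c = (LINT \<zeta>|circle_measure. F \<zeta>)"
  have Fi: "integrable circle_measure F" using F by (rule H1_function_integrable)
  have "AE \<zeta> in circle_measure. 1 * F \<zeta> + (- c) * 1 = 0"
  proof (rule H1_function_zero_if)
    show "H1_function (\<lambda>\<zeta>. 1 * F \<zeta> + (- c) * 1)"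
      by (rule H1_function_lincomb[OF F H1_function_const])
    show "(LINT \<zeta>|circle_measure. cnj \<zeta> ^ n * (1 * F \<zeta> + (- c) * 1)) = 0" for n
    proof (cases n)
      case 0
      have "(LINT \<zeta>|circle_measure. F \<zeta> - c) = c - c"
        using Fi by (subst Bochner_Integration.integral_diff) (simp_all add: c_def)
      then show ?thesis using 0 by simp
    next
      case (Suc m)
      have "H1_function (\<lambda>\<zeta>. 1 * cnj (F \<zeta>) + cnj (- c) * 1)"
        by (rule H1_function_lincomb[OF cnj H1_function_const])
      from H1_function_integral[OF this, of m]
      have "cnj (LINT \<zeta>|circle_measure. \<zeta> ^ Suc m * (1 * cnj (F \<zeta>) + cnj (- c) * 1)) = cnj 0"
        by (rule arg_cong)
      then show ?thesis unfolding Suc by (simp del: power_Suc flip: Bochner_Integration.integral_cnj)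
    qed
  qed
  then show ?thesis unfolding c_def[symmetric] by eventually_elim simp
qed

lemma square_integrable_mult_power:
  assumes "square_integrable circle_measure F"
  shows "square_integrable circle_measure (\<lambda>\<zeta>. \<zeta> ^ n * F \<zeta>)"
proof (rule square_integrable_mult_bounded[OF _ assms])
  show "AE \<zeta> in circle_measure. norm (\<zeta> ^ n) \<le> 1"
    using AE_circle_measure_norm by eventually_elim (simp add: norm_power)
qed measurable

text \<open>Consider the functions \<open>r\<close> in \<open>H\<^sup>2\<close> for which \<open>r B\<close> is analytic, and project \<open>A\<close> to this
  subspace. It contains all the powers of the coordinate, so the difference of \<open>A\<close> and its projection
  \<open>b\<close> has no nonnegative frequency; nor has it a negative one, since both functions are analytic.
  Hence \<open>A = b\<close>.\<close>

theorem H1_function_mult: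
  assumes A: "H2_function A" and B: "H2_function B"
  shows "H1_function (\<lambda>\<zeta>. A \<zeta> * B \<zeta>)"
proof -
  have A2: "square_integrable circle_measure A" and A1: "H1_function A"
    and B2: "square_integrable circle_measure B" and B1: "H1_function B"
    using A B by (simp_all add: H2_function_def)
  define \<Psi> where "\<Psi> = range (\<lambda>n \<zeta>. \<zeta> ^ Suc n * 1) \<union> range (\<lambda>n \<zeta>. \<zeta> ^ Suc n * B \<zeta>)"
  have \<Psi>: "square_integrable circle_measure \<psi>" if "\<psi> \<in> \<Psi>" for \<psi>
    using that square_integrable_mult_power[OF circle.square_integrable_const] square_integrable_mult_power[OF B2]
    unfolding \<Psi>_def by blast
  obtain b where "b \<in> {r. square_integrable circle_measure r \<and> (\<forall>\<psi>\<in>\<Psi>. (LINT \<zeta>|circle_measure. \<psi> \<zeta> * r \<zeta>) = 0)}"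
    and orth: "\<And>r. r \<in> {r. square_integrable circle_measure r \<and> (\<forall>\<psi>\<in>\<Psi>. (LINT \<zeta>|circle_measure. \<psi> \<zeta> * r \<zeta>) = 0)} \<Longrightarrow>
        (LINT \<zeta>|circle_measure. (A \<zeta> - b \<zeta>) * cnj (r \<zeta>)) = 0"
    using circle.orthogonal_projection_exists[OF \<Psi> A2] by blast
  then have b2: "square_integrable circle_measure b"
    and b0: "\<And>\<psi>. \<psi> \<in> \<Psi> \<Longrightarrow> (LINT \<zeta>|circle_measure. \<psi> \<zeta> * b \<zeta>) = 0" by auto
  have "(LINT \<zeta>|circle_measure. \<zeta> ^ Suc n * b \<zeta>) = 0" for n
    using b0[of "\<lambda>\<zeta>. \<zeta> ^ Suc n * 1"] by (auto simp: \<Psi>_def)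
  then have b1: "H1_function b"
    using circle.square_integrable_integrable[OF b2] by (simp add: H1_function_def)
  have "(LINT \<zeta>|circle_measure. \<zeta> ^ Suc n * (b \<zeta> * B \<zeta>)) = 0" for n
    using b0[of "\<lambda>\<zeta>. \<zeta> ^ Suc n * B \<zeta>"] by (auto simp: \<Psi>_def mult_ac)
  then have bB: "H1_function (\<lambda>\<zeta>. b \<zeta> * B \<zeta>)"
    using integrable_mult_square_integrable[OF b2 B2] by (simp add: H1_function_def)
  have "AE \<zeta> in circle_measure. 1 * A \<zeta> + (- 1) * b \<zeta> = 0"
  proof (rule H1_function_zero_if)
    show "H1_function (\<lambda>\<zeta>. 1 * A \<zeta> + (- 1) * b \<zeta>)" by (rule H1_function_lincomb[OF A1 b1])
    fix n
    have "(LINT \<zeta>|circle_measure. \<zeta> ^ Suc m * B \<zeta> * \<zeta> ^ n) = 0" for m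
      using H1_function_integral[OF H1_function_mult_power[OF B1, of n], of m] by (simp add: mult_ac)
    moreover have "(LINT \<zeta>|circle_measure. \<zeta> ^ Suc m * 1 * \<zeta> ^ n) = 0" for m
      using H1_function_integral[OF H1_function_mult_power[OF H1_function_const[of 1], of n], of m] by (simp add: mult_ac)
    moreover have "square_integrable circle_measure (\<lambda>\<zeta>. \<zeta> ^ n)"
      using square_integrable_mult_power[OF circle.square_integrable_const, of n 1] by simp
    ultimately have "(LINT \<zeta>|circle_measure. (A \<zeta> - b \<zeta>) * cnj (\<zeta> ^ n)) = 0"
      by (intro orth) (auto simp: \<Psi>_def simp del: power_Suc)
    then show "(LINT \<zeta>|circle_measure. cnj \<zeta> ^ n * (1 * A \<zeta> + (- 1) * b \<zeta>)) = 0"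
      by (simp add: mult.commute)
  qed
  then have "AE \<zeta> in circle_measure. b \<zeta> * B \<zeta> = A \<zeta> * B \<zeta>" by eventually_elim simp
  moreover note [measurable] = A1[THEN H1_function_measurable] B1[THEN H1_function_measurable]
  ultimately show ?thesis by (intro H1_function_cong_AE[OF bB]) measurable
qed

lemma H2_function_mult_bounded:
  assumes A: "H2_function A" and B: "H2_function B" and bd: "AE \<zeta> in circle_measure. norm (A \<zeta>) \<le> C"
  shows "H2_function (\<lambda>\<zeta>. A \<zeta> * B \<zeta>)"
proof (rule H2_functionI[OF H1_function_mult[OF A B]])
  have "square_integrable circle_measure A" using A by (simp add: H2_function_def)
  note [measurable] = square_integrable_measurable[OF this]
  show "square_integrable circle_measure (\<lambda>\<zeta>. A \<zeta> * B \<zeta>)"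
    using B bd by (intro square_integrable_mult_bounded[where C = C]) (auto simp: H2_function_def)
qed

lemma H2_function_bounded:
  assumes "H1_function A" "AE \<zeta> in circle_measure. norm (A \<zeta>) \<le> C"
  shows "H2_function A"
proof (rule H2_functionI[OF assms(1)])
  show "square_integrable circle_measure A"
    using square_integrable_mult_bounded[OF H1_function_measurable[OF assms(1)] circle.square_integrable_const[of 1] assms(2)]
    by simp
qed

section \<open>Outer functions by Szego's extremal problem\<close>

text \<open>Szego's construction. In \<open>L\<^sup>2\<close> with the weight \<open>|f|\<close>, among the analytic functions with mean
  1 take the one of least norm. Orthogonality to its own shifts makes its weighted square modulus a
  constant, and orthogonality to the shifts of 1 makes its inverse analytic. Here the weight is
  moved into the functions: \<open>s\<close> is the square root of \<open>|f|\<close>, and the minimizer is \<open>Q/s\<close> with \<open>Q\<close> the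
  component of \<open>s\<close> orthogonal to \<open>V\<close>. The second family in \<open>\<Psi>\<close> adds to the definition of \<open>V\<close> that
  the product with \<open>f\<close> be analytic. The constant is positive since \<open>s\<close> is not in \<open>V\<close>: the mean of
  \<open>r/s\<close> is 0 for \<open>r\<close> in \<open>V\<close> and 1 for \<open>r = s\<close>.\<close>

theorem outer_factor_exists:
  assumes f: "H1_function f" and nz: "\<And>\<zeta>. f \<zeta> \<noteq> 0" and inv: "integrable circle_measure (\<lambda>\<zeta>. 1 / f \<zeta>)"
  obtains q where "H2_function q" "H2_function (\<lambda>\<zeta>. 1 / q \<zeta>)" "H2_function (\<lambda>\<zeta>. f \<zeta> * q \<zeta>)"
    "\<And>\<zeta>. (norm (q \<zeta>))\<^sup>2 * norm (f \<zeta>) = 1"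
proof -
  have fi: "integrable circle_measure f" using f by (rule H1_function_integrable)
  note [measurable] = borel_measurable_integrable[OF fi]
  define s where "s \<zeta> = complex_of_real (sqrt (norm (f \<zeta>)))" for \<zeta>
  have [measurable]: "s \<in> borel_measurable circle_measure" unfolding s_def by measurable
  have s_nz: "s \<zeta> \<noteq> 0" for \<zeta> using nz[of \<zeta>] by (simp add: s_def)
  have s_norm: "(norm (s \<zeta>))\<^sup>2 = norm (f \<zeta>)" for \<zeta> by (simp add: s_def)
  have s_sq: "s \<zeta> * s \<zeta> = of_real (norm (f \<zeta>))" for \<zeta>
    by (simp add: s_def flip: of_real_mult)
  have s_si: "square_integrable circle_measure s"
    using fi by (simp add: square_integrable_def s_norm)
  have s'_si: "square_integrable circle_measure (\<lambda>\<zeta>. 1 / s \<zeta>)"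
    using integrable_norm[OF inv] by (simp add: square_integrable_def norm_divide power_divide s_norm)
  have fs_si: "square_integrable circle_measure (\<lambda>\<zeta>. f \<zeta> / s \<zeta>)"
  proof -
    have "(norm (f \<zeta> / s \<zeta>))\<^sup>2 = norm (f \<zeta>)" for \<zeta>
      unfolding norm_divide power_divide s_norm using nz[of \<zeta>] by (simp add: power2_eq_square)
    then show ?thesis using fi by (simp add: square_integrable_def)
  qed
  define \<Psi> where "\<Psi> = range (\<lambda>n \<zeta>. \<zeta> ^ n * (1 / s \<zeta>)) \<union> range (\<lambda>n \<zeta>. \<zeta> ^ Suc n * (f \<zeta> / s \<zeta>))"
  define V where "V = {r. square_integrable circle_measure r \<and> (\<forall>\<psi>\<in>\<Psi>. (LINT \<zeta>|circle_measure. \<psi> \<zeta> * r \<zeta>) = 0)}"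
  have \<Psi>: "square_integrable circle_measure \<psi>" if "\<psi> \<in> \<Psi>" for \<psi>
    using that square_integrable_mult_power[OF s'_si] square_integrable_mult_power[OF fs_si]
    unfolding \<Psi>_def by blast
  have V_iff: "r \<in> V \<longleftrightarrow> square_integrable circle_measure r \<and>
      (\<forall>n. (LINT \<zeta>|circle_measure. \<zeta> ^ n * (1 / s \<zeta>) * r \<zeta>) = 0) \<and>
      (\<forall>n. (LINT \<zeta>|circle_measure. \<zeta> ^ Suc n * (f \<zeta> / s \<zeta>) * r \<zeta>) = 0)" for r
    unfolding V_def \<Psi>_def
    by (simp only: mem_Collect_eq ball_Un ball_simps ball_UNIV simp_thms)
  obtain b where bV: "b \<in> V" and orth: "\<And>r. r \<in> V \<Longrightarrow> (LINT \<zeta>|circle_measure. (s \<zeta> - b \<zeta>) * cnj (r \<zeta>)) = 0"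
    using circle.orthogonal_projection_exists[OF \<Psi> s_si] unfolding V_def by blast
  have b_si: "square_integrable circle_measure b" using bV by (simp add: V_iff)
  note [measurable] = square_integrable_measurable[OF b_si]
  define Q where "Q \<zeta> = s \<zeta> - b \<zeta>" for \<zeta>
  have Q_si: "square_integrable circle_measure Q"
    unfolding Q_def by (intro square_integrable_diff s_si b_si)
  note [measurable] = square_integrable_measurable[OF Q_si]
  have s_shift: "(\<lambda>\<zeta>. \<zeta> ^ Suc n * s \<zeta>) \<in> V" for n
  proof -
    have "\<zeta> ^ m * (1 / s \<zeta>) * (\<zeta> ^ Suc n * s \<zeta>) = \<zeta> ^ Suc (m + n)" for m \<zeta>
      using s_nz[of \<zeta>] by (simp add: power_add)
    moreover have "\<zeta> ^ Suc m * (f \<zeta> / s \<zeta>) * (\<zeta> ^ Suc n * s \<zeta>) = \<zeta> ^ Suc (Suc (m + n)) * f \<zeta>" for m \<zeta>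
      using s_nz[of \<zeta>] by (simp add: power_add)
    ultimately show ?thesis
      unfolding V_iff
      by (simp only: square_integrable_mult_power[OF s_si] integral_circle_measure_power H1_function_integral[OF f] simp_thms)
  qed
  have b_shift: "(\<lambda>\<zeta>. \<zeta> ^ Suc n * b \<zeta>) \<in> V" for n
  proof -
    have "\<zeta> ^ m * (1 / s \<zeta>) * (\<zeta> ^ Suc n * b \<zeta>) = \<zeta> ^ (m + Suc n) * (1 / s \<zeta>) * b \<zeta>" for m \<zeta>
      by (simp add: power_add)
    moreover have "\<zeta> ^ Suc m * (f \<zeta> / s \<zeta>) * (\<zeta> ^ Suc n * b \<zeta>) = \<zeta> ^ Suc (m + Suc n) * (f \<zeta> / s \<zeta>) * b \<zeta>" for m \<zeta>
      by (simp add: power_add)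
    ultimately show ?thesis
      using bV unfolding V_iff by (simp only: square_integrable_mult_power[OF b_si] simp_thms)
  qed
  have Qs: "(LINT \<zeta>|circle_measure. \<zeta> ^ Suc n * (cnj (Q \<zeta>) * s \<zeta>)) = 0" for n
  proof -
    have "cnj (LINT \<zeta>|circle_measure. Q \<zeta> * cnj (\<zeta> ^ Suc n * s \<zeta>)) = cnj 0"
      using orth[OF s_shift] by (simp only: Q_def)
    then show ?thesis by (simp add: s_def mult_ac flip: Bochner_Integration.integral_cnj)
  qed
  have Qb: "(LINT \<zeta>|circle_measure. \<zeta> ^ Suc n * (cnj (Q \<zeta>) * b \<zeta>)) = 0" for n
  proof -
    have "cnj (LINT \<zeta>|circle_measure. Q \<zeta> * cnj (\<zeta> ^ Suc n * b \<zeta>)) = cnj 0"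
      using orth[OF b_shift] by (simp only: Q_def)
    then show ?thesis by (simp add: mult_ac flip: Bochner_Integration.integral_cnj)
  qed
  define C where "C = (LINT \<zeta>|circle_measure. (norm (Q \<zeta>))\<^sup>2)"
  have AE_Q: "AE \<zeta> in circle_measure. (norm (Q \<zeta>))\<^sup>2 = C"
  proof -
    have Qs1: "H1_function (\<lambda>\<zeta>. cnj (Q \<zeta>) * s \<zeta>)" and Qb1: "H1_function (\<lambda>\<zeta>. cnj (Q \<zeta>) * b \<zeta>)"
      unfolding H1_function_def using Qs Qb
      by (auto intro!: integrable_mult_square_integrable square_integrable_cnj Q_si s_si b_si simp del: power_Suc)
    have eq: "1 * (cnj (Q \<zeta>) * s \<zeta>) + (- 1) * (cnj (Q \<zeta>) * b \<zeta>) = of_real ((norm (Q \<zeta>))\<^sup>2)" for \<zeta>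
      unfolding complex_norm_square by (simp add: Q_def algebra_simps)
    have H: "H1_function (\<lambda>\<zeta>. complex_of_real ((norm (Q \<zeta>))\<^sup>2))"
      using H1_function_lincomb[OF Qs1 Qb1, of 1 "-1"] unfolding eq .
    have "AE \<zeta> in circle_measure. complex_of_real ((norm (Q \<zeta>))\<^sup>2) = (LINT \<zeta>|circle_measure. complex_of_real ((norm (Q \<zeta>))\<^sup>2))"
      using AE_constant_if_coefficients_zero[OF H] H by (simp del: of_real_power)
    then show ?thesis
      unfolding integral_complex_of_real C_def[symmetric] of_real_eq_iff .
  qed
  have C0: "C \<noteq> 0"
  proof
    assume "C = 0"
    have "(LINT \<zeta>|circle_measure. \<zeta> ^ 0 * (1 / s \<zeta>) * b \<zeta>) = (LINT \<zeta>|circle_measure. 1 :: complex)"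
    proof (rule integral_cong_AE)
      show "AE \<zeta> in circle_measure. \<zeta> ^ 0 * (1 / s \<zeta>) * b \<zeta> = 1"
        using AE_Q
      proof eventually_elim
        case (elim \<zeta>)
        then have "s \<zeta> = b \<zeta>" using \<open>C = 0\<close> by (simp add: Q_def)
        then show ?case using s_nz[of \<zeta>] by simp
      qed
    qed measurable
    also have "\<dots> = 1" by simp
    finally show False using bV unfolding V_iff by (metis zero_neq_one)
  qed
  have "0 \<le> C" by (simp add: C_def)
  with C0 have C: "0 < C" by simp
  define k where "k = complex_of_real (1 / sqrt C)"
  have k: "(norm k)\<^sup>2 = 1 / C" using C by (simp add: k_def norm_divide power_divide)
  \<comment> \<open>the values on the exceptional null set are chosen such that the modulus is right everywhere\<close>
  define q where "q \<zeta> = (if (norm (Q \<zeta>))\<^sup>2 = C then k * (Q \<zeta> / s \<zeta>) else 1 / s \<zeta>)" for \<zeta>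
  have [measurable]: "q \<in> borel_measurable circle_measure" unfolding q_def by measurable
  have q_norm: "(norm (q \<zeta>))\<^sup>2 * norm (f \<zeta>) = 1" for \<zeta>
    using nz[of \<zeta>] C by (auto simp: q_def norm_mult norm_divide power_mult_distrib power_divide s_norm k)
  have q_nz: "q \<zeta> \<noteq> 0" for \<zeta> using q_norm[of \<zeta>] by auto
  have q_eq: "AE \<zeta> in circle_measure. q \<zeta> = k * (Q \<zeta> / s \<zeta>)"
    using AE_Q by eventually_elim (simp add: q_def)
  have q_sq: "(norm (q \<zeta>))\<^sup>2 = norm (1 / f \<zeta>)" for \<zeta>
    using q_norm[of \<zeta>] nz[of \<zeta>] by (simp add: norm_divide field_simps)
  have int1: "integrable circle_measure (\<lambda>\<zeta>. Q \<zeta> / s \<zeta>)"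
    using integrable_mult_square_integrable[OF Q_si s'_si] by simp
  have H_Qs: "H1_function (\<lambda>\<zeta>. Q \<zeta> / s \<zeta>)"
    unfolding H1_function_def
  proof (intro conjI allI int1)
    fix n
    have "(LINT \<zeta>|circle_measure. \<zeta> ^ Suc n * (Q \<zeta> / s \<zeta>)) =
        (LINT \<zeta>|circle_measure. \<zeta> ^ Suc n - \<zeta> ^ Suc n * (1 / s \<zeta>) * b \<zeta>)"
      using s_nz by (intro Bochner_Integration.integral_cong) (simp_all add: Q_def divide_simps algebra_simps)
    also have "\<dots> = (LINT \<zeta>|circle_measure. \<zeta> ^ Suc n) - (LINT \<zeta>|circle_measure. \<zeta> ^ Suc n * (1 / s \<zeta>) * b \<zeta>)"
    proof (rule Bochner_Integration.integral_diff)
      show "integrable circle_measure (\<lambda>\<zeta>. \<zeta> ^ Suc n)"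
        using integrable_power_mult[of "\<lambda>_. 1" "Suc n"] by simp
      show "integrable circle_measure (\<lambda>\<zeta>. \<zeta> ^ Suc n * (1 / s \<zeta>) * b \<zeta>)"
        by (intro integrable_mult_square_integrable square_integrable_mult_power s'_si b_si)
    qed
    also have "\<dots> = 0" using bV unfolding V_iff by (simp only: integral_circle_measure_power diff_self)
    finally show "(LINT \<zeta>|circle_measure. \<zeta> ^ Suc n * (Q \<zeta> / s \<zeta>)) = 0" .
  qed
  have H_fQs: "H1_function (\<lambda>\<zeta>. f \<zeta> * (Q \<zeta> / s \<zeta>))"
    unfolding H1_function_def
  proof (intro conjI allI)
    show "integrable circle_measure (\<lambda>\<zeta>. f \<zeta> * (Q \<zeta> / s \<zeta>))"
      using integrable_mult_square_integrable[OF Q_si fs_si] by (simp add: mult_ac)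
    fix n
    have "(LINT \<zeta>|circle_measure. \<zeta> ^ Suc n * (f \<zeta> * (Q \<zeta> / s \<zeta>))) =
        (LINT \<zeta>|circle_measure. \<zeta> ^ Suc n * f \<zeta> - \<zeta> ^ Suc n * (f \<zeta> / s \<zeta>) * b \<zeta>)"
      using s_nz by (intro Bochner_Integration.integral_cong) (simp_all add: Q_def divide_simps algebra_simps)
    also have "\<dots> = (LINT \<zeta>|circle_measure. \<zeta> ^ Suc n * f \<zeta>) - (LINT \<zeta>|circle_measure. \<zeta> ^ Suc n * (f \<zeta> / s \<zeta>) * b \<zeta>)"
    proof (rule Bochner_Integration.integral_diff)
      show "integrable circle_measure (\<lambda>\<zeta>. \<zeta> ^ Suc n * f \<zeta>)" by (rule integrable_power_mult[OF fi])
      show "integrable circle_measure (\<lambda>\<zeta>. \<zeta> ^ Suc n * (f \<zeta> / s \<zeta>) * b \<zeta>)"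
        by (intro integrable_mult_square_integrable square_integrable_mult_power fs_si b_si)
    qed
    also have "\<dots> = 0" using bV unfolding V_iff by (simp only: H1_function_integral[OF f] diff_self)
    finally show "(LINT \<zeta>|circle_measure. \<zeta> ^ Suc n * (f \<zeta> * (Q \<zeta> / s \<zeta>))) = 0" .
  qed
  have H_sQ: "H1_function (\<lambda>\<zeta>. cnj (Q \<zeta>) * s \<zeta>)"
    unfolding H1_function_def using Qs
    by (auto intro!: integrable_mult_square_integrable square_integrable_cnj Q_si s_si simp del: power_Suc)
  show thesis
  proof
    show "(norm (q \<zeta>))\<^sup>2 * norm (f \<zeta>) = 1" for \<zeta> by (rule q_norm)
    show "H2_function q"
    proof (rule H2_functionI)
      show "H1_function q"
        by (rule H1_function_cong_AE[OF H1_function_cmult[OF H_Qs, of k]]) (use q_eq in auto)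
      show "square_integrable circle_measure q"
        using integrable_norm[OF inv] by (simp add: square_integrable_def q_sq)
    qed
    show "H2_function (\<lambda>\<zeta>. 1 / q \<zeta>)"
    proof (rule H2_functionI)
      have "1 / q \<zeta> = cnj (q \<zeta>) * s \<zeta> * s \<zeta>" for \<zeta>
      proof -
        have "q \<zeta> * cnj (q \<zeta>) * (s \<zeta> * s \<zeta>) = of_real ((norm (q \<zeta>))\<^sup>2 * norm (f \<zeta>))"
          unfolding of_real_mult complex_norm_square s_sq ..
        also have "\<dots> = 1" by (simp only: q_norm of_real_1)
        finally show ?thesis using q_nz[of \<zeta>] by (simp add: field_simps)
      qed
      then have "AE \<zeta> in circle_measure. k * (cnj (Q \<zeta>) * s \<zeta>) = 1 / q \<zeta>"
        using q_eq by (auto elim!: eventually_mono simp: k_def s_def nz)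
      then show "H1_function (\<lambda>\<zeta>. 1 / q \<zeta>)"
        by (intro H1_function_cong_AE[OF H1_function_cmult[OF H_sQ, of k]]) measurable
      have "(norm (1 / q \<zeta>))\<^sup>2 = norm (f \<zeta>)" for \<zeta>
        using q_norm[of \<zeta>] q_nz[of \<zeta>] by (simp add: norm_divide power_divide field_simps)
      then show "square_integrable circle_measure (\<lambda>\<zeta>. 1 / q \<zeta>)"
        using fi by (simp add: square_integrable_def)
    qed
    show "H2_function (\<lambda>\<zeta>. f \<zeta> * q \<zeta>)"
    proof (rule H2_functionI)
      have "AE \<zeta> in circle_measure. k * (f \<zeta> * (Q \<zeta> / s \<zeta>)) = f \<zeta> * q \<zeta>"
        using q_eq by eventually_elim simp
      then show "H1_function (\<lambda>\<zeta>. f \<zeta> * q \<zeta>)"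
        by (intro H1_function_cong_AE[OF H1_function_cmult[OF H_fQs, of k]]) measurable
      have "(norm (f \<zeta> * q \<zeta>))\<^sup>2 = norm (f \<zeta>)" for \<zeta>
      proof -
        have "(norm (f \<zeta> * q \<zeta>))\<^sup>2 = norm (f \<zeta>) * ((norm (q \<zeta>))\<^sup>2 * norm (f \<zeta>))"
          by (simp add: norm_mult power2_eq_square)
        then show ?thesis by (simp only: q_norm mult_1_right)
      qed
      then show "square_integrable circle_measure (\<lambda>\<zeta>. f \<zeta> * q \<zeta>)"
        using fi by (simp add: square_integrable_def)
    qed
  qed
qed

section \<open>Backward shifts of a unimodular function\<close>

text \<open>Gaussian elimination: a homogeneous real system with more unknowns than equations.\<close>

lemma nontrivial_real_solution_exists:
  fixes L :: "'k \<Rightarrow> 'i \<Rightarrow> real"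
  assumes "finite K" "finite I" "card K < card I"
  shows "\<exists>x. (\<exists>i\<in>I. x i \<noteq> 0) \<and> (\<forall>k\<in>K. (\<Sum>i\<in>I. x i * L k i) = 0)"
  using assms
proof (induction K arbitrary: I L rule: finite_induct)
  case empty
  then obtain i where "i \<in> I" by fastforce
  then show ?case by (intro exI[of _ "\<lambda>_. 1"]) auto
next
  case (insert k K)
  show ?case
  proof (cases "\<forall>i\<in>I. L k i = 0")
    case True
    have "card K < card I" using insert by simp
    from insert.IH[OF insert.prems(1) this, of L] True show ?thesis by auto
  next
    case False
    then obtain j where j: "j \<in> I" "L k j \<noteq> 0" by blast
    define L' where "L' m i = L m i - L k i / L k j * L m j" for m i
    have "card K < card (I - {j})" using insert j by simp
    from insert.IH[OF _ this, of L'] insert.prems obtain x where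
      x: "\<exists>i\<in>I - {j}. x i \<noteq> 0" "\<forall>m\<in>K. (\<Sum>i\<in>I - {j}. x i * L' m i) = 0" by auto
    define S where "S = (\<Sum>i\<in>I - {j}. x i * L k i)"
    define y where "y = x(j := - S / L k j)"
    have sum: "(\<Sum>i\<in>I. y i * L m i) = - S / L k j * L m j + (\<Sum>i\<in>I - {j}. x i * L m i)" for m
      using insert.prems(1) j(1) by (subst sum.remove[of I j]) (auto simp: y_def intro!: sum.cong)
    have "(\<Sum>i\<in>I. y i * L k i) = 0" using sum[of k] j by (simp add: S_def)
    moreover have "(\<Sum>i\<in>I. y i * L m i) = 0" if "m \<in> K" for m
    proof -
      have "(\<Sum>i\<in>I - {j}. x i * L' m i) = (\<Sum>i\<in>I - {j}. x i * L m i) - S / L k j * L m j"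
      proof -
        have "(\<Sum>i\<in>I - {j}. x i * L' m i) = (\<Sum>i\<in>I - {j}. x i * L m i - x i * L k i * (L m j / L k j))"
          by (intro sum.cong) (simp_all add: L'_def algebra_simps)
        also have "\<dots> = (\<Sum>i\<in>I - {j}. x i * L m i) - S * (L m j / L k j)"
          by (simp only: sum_subtractf S_def sum_distrib_right)
        finally show ?thesis by simp
      qed
      with x(2) that sum[of m] show ?thesis by simp
    qed
    moreover have "\<exists>i\<in>I. y i \<noteq> 0" using x(1) by (auto simp: y_def)
    ultimately show ?thesis by blast
  qed
qed

text \<open>The function \<open>F - F(0)\<close> divided by the coordinate, where \<open>F(0)\<close> is the value at the origin of the
  analytic extension of \<open>F\<close>.\<close>

definition backward_shift :: "(complex \<Rightarrow> complex) \<Rightarrow> complex \<Rightarrow> complex" where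
  "backward_shift F \<zeta> = cnj \<zeta> * (F \<zeta> - (LINT \<zeta>|circle_measure. F \<zeta>))"

lemma backward_shift_measurable:
  assumes [measurable]: "F \<in> borel_measurable circle_measure"
  shows "backward_shift F \<in> borel_measurable circle_measure"
  unfolding backward_shift_def[abs_def] by measurable

lemma AE_mult_backward_shift:
  "AE \<zeta> in circle_measure. \<zeta> * backward_shift F \<zeta> = F \<zeta> - (LINT \<zeta>|circle_measure. F \<zeta>)"
  using AE_circle_measure_mult_cnj
proof eventually_elim
  case (elim \<zeta>)
  have "\<zeta> * backward_shift F \<zeta> = \<zeta> * cnj \<zeta> * (F \<zeta> - (LINT \<zeta>|circle_measure. F \<zeta>))"
    by (simp only: backward_shift_def mult.assoc)
  then show ?case unfolding elim by simp
qed

lemma H1_function_backward_shift: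
  assumes "H1_function F"
  shows "H1_function (backward_shift F)"
proof -
  note [measurable] = H1_function_measurable[OF assms] backward_shift_measurable[OF H1_function_measurable[OF assms]]
  have Fi: "integrable circle_measure F" using assms by (rule H1_function_integrable)
  define c where "c = (LINT \<zeta>|circle_measure. F \<zeta>)"
  have "integrable circle_measure (backward_shift F)"
    unfolding backward_shift_def[abs_def] using integrable_cnj_power_mult[of "\<lambda>\<zeta>. F \<zeta> - c" 1] Fi
    by (simp add: c_def)
  moreover have "(LINT \<zeta>|circle_measure. \<zeta> ^ Suc n * backward_shift F \<zeta>) = 0" for n
  proof -
    have "(LINT \<zeta>|circle_measure. \<zeta> ^ Suc n * backward_shift F \<zeta>) = (LINT \<zeta>|circle_measure. \<zeta> ^ n * (1 * F \<zeta> + (- c) * 1))"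
    proof (rule integral_cong_AE)
      show "AE \<zeta> in circle_measure. \<zeta> ^ Suc n * backward_shift F \<zeta> = \<zeta> ^ n * (1 * F \<zeta> + (- c) * 1)"
        using AE_mult_backward_shift[of F]
      proof eventually_elim
        case (elim \<zeta>)
        have "\<zeta> ^ Suc n * backward_shift F \<zeta> = \<zeta> ^ n * (\<zeta> * backward_shift F \<zeta>)" by simp
        also have "\<dots> = \<zeta> ^ n * (1 * F \<zeta> + (- c) * 1)" unfolding elim c_def by simp
        finally show ?case .
      qed
    qed measurable
    also have "\<dots> = 0"
    proof (cases n)
      case 0
      have "(LINT \<zeta>|circle_measure. F \<zeta> - c) = c - c"
        using Fi by (subst Bochner_Integration.integral_diff) (simp_all add: c_def)
      then show ?thesis using 0 by simp
    next
      case (Suc m)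
      show ?thesis
        unfolding Suc by (intro H1_function_integral H1_function_lincomb H1_function_const assms)
    qed
    finally show ?thesis .
  qed
  ultimately show ?thesis by (simp add: H1_function_def del: power_Suc)
qed

lemma backward_shift_bounded:
  assumes "AE \<zeta> in circle_measure. norm (F \<zeta>) \<le> C"
  shows "AE \<zeta> in circle_measure. norm (backward_shift F \<zeta>) \<le> C + norm (LINT \<zeta>|circle_measure. F \<zeta>)"
  using assms AE_circle_measure_norm
proof eventually_elim
  case (elim \<zeta>)
  have "norm (backward_shift F \<zeta>) = norm (F \<zeta> - (LINT \<zeta>|circle_measure. F \<zeta>))"
    using elim by (simp add: backward_shift_def norm_mult)
  also have "\<dots> \<le> norm (F \<zeta>) + norm (LINT \<zeta>|circle_measure. F \<zeta>)" by (rule norm_triangle_ineq4)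
  finally show ?case using elim by linarith
qed

text \<open>The frequencies of \<open>R\<close> lie between 0 and \<open>n\<close>. The backward shift lowers the upper bound.\<close>

lemma AE_bounded_if_H1_reflection:
  assumes "H1_function R" "H1_function (\<lambda>\<zeta>. \<zeta> ^ n * cnj (R \<zeta>))"
  shows "\<exists>C. AE \<zeta> in circle_measure. norm (R \<zeta>) \<le> C"
  using assms
proof (induction n arbitrary: R)
  case 0
  then have "AE \<zeta> in circle_measure. R \<zeta> = (LINT \<zeta>|circle_measure. R \<zeta>)"
    by (intro AE_constant_if_coefficients_zero) simp_all
  then have "AE \<zeta> in circle_measure. norm (R \<zeta>) \<le> norm (LINT \<zeta>|circle_measure. R \<zeta>)"
    by eventually_elim simp
  then show ?case ..
next
  case (Suc n)
  define c where "c = (LINT \<zeta>|circle_measure. R \<zeta>)"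
  note [measurable] = H1_function_measurable[OF Suc.prems(1)] backward_shift_measurable[OF H1_function_measurable[OF Suc.prems(1)]]
  have "H1_function (\<lambda>\<zeta>. 1 * (\<zeta> ^ Suc n * cnj (R \<zeta>)) + (- cnj c) * (\<zeta> ^ Suc n * 1))"
    by (intro H1_function_lincomb Suc.prems H1_function_mult_power H1_function_const)
  then have "H1_function (\<lambda>\<zeta>. \<zeta> ^ n * cnj (backward_shift R \<zeta>))"
    by (rule H1_function_cong_AE) (measurable, simp add: backward_shift_def c_def algebra_simps)
  from Suc.IH[OF H1_function_backward_shift[OF Suc.prems(1)] this]
  obtain C where "AE \<zeta> in circle_measure. norm (backward_shift R \<zeta>) \<le> C" ..
  then have "AE \<zeta> in circle_measure. norm (R \<zeta>) \<le> C + norm c"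
    using AE_mult_backward_shift[of R] AE_circle_measure_norm
  proof eventually_elim
    case (elim \<zeta>)
    have "R \<zeta> = \<zeta> * backward_shift R \<zeta> + c" using elim(2) by (simp add: c_def)
    then have "norm (R \<zeta>) \<le> norm (\<zeta> * backward_shift R \<zeta>) + norm c" by (metis norm_triangle_ineq)
    moreover have "norm (\<zeta> * backward_shift R \<zeta>) = norm (backward_shift R \<zeta>)"
      unfolding norm_mult elim(3) by simp
    ultimately show ?case using elim(1) by linarith
  qed
  then show ?case ..
qed

lemma conjugate_polynomial_exists:
  "\<exists>n p'. \<forall>\<zeta>. \<zeta> * cnj \<zeta> = 1 \<longrightarrow> \<zeta> ^ n * cnj (poly p \<zeta>) = poly p' \<zeta>"
proof (induction p)
  case 0
  show ?case by (intro exI[of _ 0] exI[of _ "0 :: complex poly"]) simp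
next
  case (pCons a p)
  then obtain n p' where p': "\<And>\<zeta>. \<zeta> * cnj \<zeta> = 1 \<Longrightarrow> \<zeta> ^ n * cnj (poly p \<zeta>) = poly p' \<zeta>" by blast
  have "\<zeta> ^ Suc n * cnj (poly (pCons a p) \<zeta>) = poly (monom (cnj a) (Suc n) + p') \<zeta>" if "\<zeta> * cnj \<zeta> = 1" for \<zeta>
  proof -
    have "\<zeta> ^ Suc n * cnj (poly (pCons a p) \<zeta>) = cnj a * \<zeta> ^ Suc n + (\<zeta> * cnj \<zeta>) * (\<zeta> ^ n * cnj (poly p \<zeta>))"
      by (simp add: algebra_simps)
    also have "\<dots> = poly (monom (cnj a) (Suc n) + p') \<zeta>"
      unfolding that p'[OF that] by (simp add: poly_monom)
    finally show ?thesis .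
  qed
  then show ?case by blast
qed

text \<open>The product \<open>p cnj W = t u cnj W\<close> is analytic, and so is its conjugate after multiplication by a
  power of the coordinate. So the product is a trigonometric polynomial, and \<open>p\<close> is bounded away
  from zero.\<close>

lemma AE_bounded_if_rational_symbol:
  assumes uO: "H1_function (\<lambda>\<zeta>. u \<zeta> * cnj (W \<zeta>))" and W: "H1_function W"
    and u: "AE \<zeta> in circle_measure. u \<zeta> * poly t \<zeta> = poly p \<zeta>"
    and p: "\<And>\<zeta>. norm \<zeta> = 1 \<Longrightarrow> poly p \<zeta> \<noteq> 0"
  shows "\<exists>C. AE \<zeta> in circle_measure. norm (W \<zeta>) \<le> C"
proof -
  note [measurable] = H1_function_measurable[OF W] H1_function_measurable[OF H1_function_poly]
  have R: "H1_function (\<lambda>\<zeta>. poly p \<zeta> * cnj (W \<zeta>))"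
  proof (rule H1_function_cong_AE[OF H1_function_mult_poly[OF uO, of t]])
    show "AE \<zeta> in circle_measure. poly t \<zeta> * (u \<zeta> * cnj (W \<zeta>)) = poly p \<zeta> * cnj (W \<zeta>)"
      using u
    proof eventually_elim
      case (elim \<zeta>)
      show ?case unfolding elim[symmetric] by simp
    qed
  qed measurable
  obtain n p' where p': "\<And>\<zeta>. \<zeta> * cnj \<zeta> = 1 \<Longrightarrow> \<zeta> ^ n * cnj (poly p \<zeta>) = poly p' \<zeta>"
    using conjugate_polynomial_exists[of p] by blast
  have "H1_function (\<lambda>\<zeta>. \<zeta> ^ n * cnj (poly p \<zeta> * cnj (W \<zeta>)))"
  proof (rule H1_function_cong_AE[OF H1_function_mult_poly[OF W, of p']])
    show "AE \<zeta> in circle_measure. poly p' \<zeta> * W \<zeta> = \<zeta> ^ n * cnj (poly p \<zeta> * cnj (W \<zeta>))"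
      using AE_circle_measure_mult_cnj
    proof eventually_elim
      case (elim \<zeta>)
      show ?case unfolding p'[OF elim, symmetric] by simp
    qed
  qed measurable
  from AE_bounded_if_H1_reflection[OF R this]
  obtain C where C: "AE \<zeta> in circle_measure. norm (poly p \<zeta> * cnj (W \<zeta>)) \<le> C" ..
  have "continuous_on (sphere 0 1) (\<lambda>\<zeta>. norm (poly p \<zeta>))" by (intro continuous_intros)
  then obtain z where z: "z \<in> sphere 0 1" "\<And>\<zeta>. \<zeta> \<in> sphere 0 1 \<Longrightarrow> norm (poly p z) \<le> norm (poly p \<zeta>)"
    using continuous_attains_inf[OF compact_sphere, of 0 1 "\<lambda>\<zeta>. norm (poly p \<zeta>)"] by auto
  then have pos: "0 < norm (poly p z)" using p by auto
  have "AE \<zeta> in circle_measure. norm (W \<zeta>) \<le> C / norm (poly p z)"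
    using C AE_circle_measure_norm
  proof eventually_elim
    case (elim \<zeta>)
    have "norm (poly p z) * norm (W \<zeta>) \<le> norm (poly p \<zeta>) * norm (W \<zeta>)"
      using z(2)[of \<zeta>] elim by (intro mult_right_mono) auto
    also have "\<dots> \<le> C" using elim by (simp add: norm_mult)
    finally show ?case using pos by (simp add: field_simps)
  qed
  then show ?thesis ..
qed

text \<open>In a representation with \<open>t\<close> of least degree, a zero of \<open>p\<close> on the circle would be a zero of \<open>t\<close>
  too, as both polynomials have the same modulus there, and the common linear factor would cancel.\<close>

lemma rational_symbol_without_zeros:
  assumes u: "AE \<zeta> in circle_measure. norm (u \<zeta>) = 1"
    and ex: "\<exists>t p. t \<noteq> 0 \<and> (AE \<zeta> in circle_measure. u \<zeta> * poly t \<zeta> = poly p \<zeta>)"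
  shows "\<exists>t p. (AE \<zeta> in circle_measure. u \<zeta> * poly t \<zeta> = poly p \<zeta>) \<and> (\<forall>\<zeta>. norm \<zeta> = 1 \<longrightarrow> poly p \<zeta> \<noteq> 0)"
proof -
  define P where "P t \<longleftrightarrow> t \<noteq> 0 \<and> (\<exists>p. AE \<zeta> in circle_measure. u \<zeta> * poly t \<zeta> = poly p \<zeta>)" for t
  have "\<exists>t. P t" using ex by (auto simp: P_def)
  then obtain t where "P t" and min: "\<And>t'. P t' \<Longrightarrow> degree t \<le> degree t'"
    using exists_least_iff[of "\<lambda>n. \<exists>t. P t \<and> degree t = n"] by (metis not_le)
  then obtain p where t: "t \<noteq> 0" and p: "AE \<zeta> in circle_measure. u \<zeta> * poly t \<zeta> = poly p \<zeta>"
    by (auto simp: P_def)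
  have "poly p z \<noteq> 0" if z: "norm z = 1" for z
  proof
    assume pz: "poly p z = 0"
    have "norm (poly t z) - norm (poly p z) = 0"
    proof (rule continuous_AE_circle_eq_0[OF _ _ z])
      show "AE \<zeta> in circle_measure. norm (poly t \<zeta>) - norm (poly p \<zeta>) = 0"
        using p u
      proof eventually_elim
        case (elim \<zeta>)
        have "norm (poly p \<zeta>) = norm (u \<zeta>) * norm (poly t \<zeta>)" unfolding elim(1)[symmetric] by (rule norm_mult)
        then show ?case using elim by simp
      qed
    qed (intro continuous_intros)
    then have tz: "poly t z = 0" using pz by simp
    obtain t' where t': "t = [:- z, 1:] * t'" using tz by (auto simp: poly_eq_0_iff_dvd elim: dvdE)
    obtain p' where p': "p = [:- z, 1:] * p'" using pz by (auto simp: poly_eq_0_iff_dvd elim: dvdE)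
    have "t' \<noteq> 0" using t t' by auto
    have "AE \<zeta> in circle_measure. u \<zeta> * poly t' \<zeta> = poly p' \<zeta>"
      using p AE_circle_measure_neq[of z]
    proof eventually_elim
      case (elim \<zeta>)
      have "(\<zeta> - z) * (u \<zeta> * poly t' \<zeta>) = (\<zeta> - z) * poly p' \<zeta>"
        using elim(1) by (simp add: t' p' algebra_simps)
      then show ?case using elim(2) by simp
    qed
    then have "P t'" using \<open>t' \<noteq> 0\<close> by (auto simp: P_def)
    then have "degree t \<le> degree t'" by (rule min)
    moreover have "degree t = Suc (degree t')"
      unfolding t' using \<open>t' \<noteq> 0\<close> by (subst degree_mult_eq) auto
    ultimately show False by simp
  qed
  with p show ?thesis by blast
qed

text \<open>That \<open>u cnj (W n)\<close> is analytic is seen step by step: it equals 1 for \<open>n = 0\<close> because \<open>u\<close> is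
  unimodular, and since conjugation turns the division by the coordinate into a multiplication,
  every shift multiplies it by the coordinate and subtracts a multiple of the coordinate times \<open>u\<close>.\<close>

lemma iterated_backward_shift:
  fixes u :: "complex \<Rightarrow> complex"
  assumes u: "H1_function u" and u_norm: "AE \<zeta> in circle_measure. norm (u \<zeta>) = 1"
  defines "W \<equiv> (\<lambda>n. (backward_shift ^^ n) u)"
  shows "H1_function (W n)"
    and "\<exists>C. AE \<zeta> in circle_measure. norm (W n \<zeta>) \<le> C"
    and "H1_function (\<lambda>\<zeta>. u \<zeta> * cnj (W n \<zeta>))"
    and "\<exists>p. AE \<zeta> in circle_measure. \<zeta> ^ n * W n \<zeta> = u \<zeta> - poly p \<zeta>"
proof -
  show W: "H1_function (W n)" for n
    unfolding W_def by (induction n) (auto intro: H1_function_backward_shift u)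
  note [measurable] = H1_function_measurable[OF W] H1_function_measurable[OF u]
  have W_Suc: "W (Suc n) = backward_shift (W n)" for n by (simp add: W_def)
  show "\<exists>C. AE \<zeta> in circle_measure. norm (W n \<zeta>) \<le> C"
  proof (induction n)
    case 0
    have "AE \<zeta> in circle_measure. norm (W 0 \<zeta>) \<le> 1" using u_norm by eventually_elim (simp add: W_def)
    then show ?case ..
  next
    case (Suc n)
    then show ?case unfolding W_Suc using backward_shift_bounded by blast
  qed
  show "H1_function (\<lambda>\<zeta>. u \<zeta> * cnj (W n \<zeta>))"
  proof (induction n)
    case 0
    have "AE \<zeta> in circle_measure. 1 = u \<zeta> * cnj (W 0 \<zeta>)"
      using u_norm by eventually_elim (simp add: W_def complex_mult_cnj cmod_def)
    then show ?case by (intro H1_function_cong_AE[OF H1_function_const]) measurable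
  next
    case (Suc n)
    define c where "c = (LINT \<zeta>|circle_measure. W n \<zeta>)"
    have "H1_function (\<lambda>\<zeta>. 1 * (\<zeta> ^ 1 * (u \<zeta> * cnj (W n \<zeta>))) + (- cnj c) * (\<zeta> ^ 1 * u \<zeta>))"
      by (intro H1_function_lincomb H1_function_mult_power Suc u)
    moreover have "1 * (\<zeta> ^ 1 * (u \<zeta> * cnj (W n \<zeta>))) + (- cnj c) * (\<zeta> ^ 1 * u \<zeta>) = u \<zeta> * cnj (W (Suc n) \<zeta>)" for \<zeta>
      by (simp add: W_Suc backward_shift_def c_def algebra_simps)
    ultimately show ?case by simp
  qed
  show "\<exists>p. AE \<zeta> in circle_measure. \<zeta> ^ n * W n \<zeta> = u \<zeta> - poly p \<zeta>"
  proof (induction n)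
    case 0
    show ?case by (intro exI[of _ 0]) (simp add: W_def)
  next
    case (Suc n)
    then obtain p where p: "AE \<zeta> in circle_measure. \<zeta> ^ n * W n \<zeta> = u \<zeta> - poly p \<zeta>" ..
    define c where "c = (LINT \<zeta>|circle_measure. W n \<zeta>)"
    have "AE \<zeta> in circle_measure. \<zeta> ^ Suc n * W (Suc n) \<zeta> = u \<zeta> - poly (p + monom c n) \<zeta>"
      using p AE_mult_backward_shift[of "W n"]
    proof eventually_elim
      case (elim \<zeta>)
      have "\<zeta> ^ Suc n * W (Suc n) \<zeta> = \<zeta> ^ n * (\<zeta> * backward_shift (W n) \<zeta>)" by (simp add: W_Suc)
      also have "\<dots> = \<zeta> ^ n * W n \<zeta> - c * \<zeta> ^ n" unfolding elim(2) c_def by (simp add: algebra_simps)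
      also have "\<dots> = u \<zeta> - poly (p + monom c n) \<zeta>" unfolding elim(1) by (simp add: poly_monom)
      finally show ?case .
    qed
    then show ?case ..
  qed
qed

lemma H1_function_sum:
  assumes "\<And>i. i \<in> I \<Longrightarrow> H1_function (F i)"
  shows "H1_function (\<lambda>\<zeta>. \<Sum>i\<in>I. c i * F i \<zeta>)"
  using assms
proof (induction I rule: infinite_finite_induct)
  case (insert i I)
  have "H1_function (\<lambda>\<zeta>. c i * F i \<zeta> + 1 * (\<Sum>i\<in>I. c i * F i \<zeta>))"
    using insert by (intro H1_function_lincomb) auto
  then show ?case using insert by simp
qed (use H1_function_const[of 0] in simp_all)

lemma integrable_cnj_powi_mult:
  assumes "integrable circle_measure F"
  shows "integrable circle_measure (\<lambda>\<zeta>. cnj \<zeta> powi k * F \<zeta>)"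
proof (rule integrable_mult_bounded[OF _ assms])
  show "(\<lambda>\<zeta>. cnj \<zeta> powi k) \<in> borel_measurable circle_measure"
    unfolding power_int_def by (cases "k \<ge> 0") simp_all
  show "AE \<zeta> in circle_measure. norm (cnj \<zeta> powi k) \<le> 1"
    using AE_circle_measure_norm by eventually_elim (simp add: norm_power_int)
qed

section \<open>Rationality of the inner factor\<close>

text \<open>Here \<open>u = f q\<^sup>2\<close> and \<open>W n\<close> is its \<open>n\<close>-th backward shift, so \<open>\<zeta>\<^sup>n W n = u - p n\<close> with
  a polynomial \<open>p n\<close>. Analyticity of \<open>u w\<close> for a bounded \<open>w\<close> implies that of \<open>f w\<close>, because
  \<open>f w = u w / q\<^sup>2\<close> and \<open>1/q\<close> is in \<open>H\<^sup>2\<close>; this applies to \<open>w = W n\<close> and to its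
  conjugate. There are \<open>2 (|K| + 1)\<close> real functions, the parts of \<open>W n\<close> for \<open>n \<le> |K|\<close>, against
  \<open>2 |K|\<close> real conditions. A combination \<open>Y\<close> of the \<open>W n\<close> with constant real part is constant, being
  analytic together with its conjugate, and multiplied by \<open>\<zeta>\<close> to the power \<open>N\<close> its equation with
  that constant becomes \<open>u t = P\<close>.\<close>

lemma rational_symbol_if_bounded_multipliers_constant:
  fixes f q :: "complex \<Rightarrow> complex" and K :: "int set"
  assumes K: "finite K"
    and f: "integrable circle_measure f"
    and q: "H2_function q" "H2_function (\<lambda>\<zeta>. 1 / q \<zeta>)" "H2_function (\<lambda>\<zeta>. f \<zeta> * q \<zeta>)"
    and q_norm: "\<And>\<zeta>. (norm (q \<zeta>))\<^sup>2 * norm (f \<zeta>) = 1"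
    and const: "\<And>(h :: complex \<Rightarrow> real) (B :: real). \<lbrakk>h \<in> borel_measurable circle_measure;
        AE \<zeta> in circle_measure. \<bar>h \<zeta>\<bar> \<le> B; H1_function (\<lambda>\<zeta>. of_real (h \<zeta>) * f \<zeta>);
        \<And>k. k \<in> K \<Longrightarrow> (LINT \<zeta>|circle_measure. cnj \<zeta> powi k * (of_real (h \<zeta>) * f \<zeta>)) = 0\<rbrakk>
        \<Longrightarrow> \<exists>c::real. AE \<zeta> in circle_measure. h \<zeta> = c"
  shows "\<exists>t p. t \<noteq> 0 \<and> (AE \<zeta> in circle_measure. f \<zeta> * q \<zeta> * q \<zeta> * poly t \<zeta> = poly p \<zeta>)"
proof -
  define u where "u \<zeta> = f \<zeta> * q \<zeta> * q \<zeta>" for \<zeta>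
  have u: "H1_function u" unfolding u_def using H1_function_mult[OF q(3) q(1)] by simp
  have u_norm: "norm (u \<zeta>) = 1" for \<zeta>
  proof -
    have "norm (u \<zeta>) = (norm (q \<zeta>))\<^sup>2 * norm (f \<zeta>)"
      by (simp add: u_def norm_mult power2_eq_square)
    then show ?thesis by (simp only: q_norm)
  qed
  have q_nz: "q \<zeta> \<noteq> 0" for \<zeta> using q_norm[of \<zeta>] by auto
  define W where "W n = (backward_shift ^^ n) u" for n
  have W1: "H1_function (W n)" and W_bdd: "\<exists>C. AE \<zeta> in circle_measure. norm (W n \<zeta>) \<le> C"
    and uW: "H1_function (\<lambda>\<zeta>. u \<zeta> * cnj (W n \<zeta>))"
    and W_poly: "\<exists>p. AE \<zeta> in circle_measure. \<zeta> ^ n * W n \<zeta> = u \<zeta> - poly p \<zeta>" for n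
    using iterated_backward_shift[OF u AE_I2[OF u_norm], of n] by (simp_all add: W_def)
  note [measurable] = H1_function_measurable[OF W1] borel_measurable_integrable[OF f]
  have mult: "H1_function (\<lambda>\<zeta>. f \<zeta> * w \<zeta>)"
    if w: "H1_function (\<lambda>\<zeta>. u \<zeta> * w \<zeta>)" and bd: "AE \<zeta> in circle_measure. norm (w \<zeta>) \<le> C" for w C
  proof -
    have bd': "AE \<zeta> in circle_measure. norm (u \<zeta> * w \<zeta>) \<le> C"
      using bd by eventually_elim (simp add: norm_mult u_norm)
    have "H2_function (\<lambda>\<zeta>. u \<zeta> * w \<zeta> * (1 / q \<zeta>))"
      by (rule H2_function_mult_bounded[OF H2_function_bounded[OF w bd'] q(2) bd'])
    from H1_function_mult[OF this q(2)]
    have "H1_function (\<lambda>\<zeta>. u \<zeta> * w \<zeta> * (1 / q \<zeta>) * (1 / q \<zeta>))" .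
    moreover have "u \<zeta> * w \<zeta> * (1 / q \<zeta>) * (1 / q \<zeta>) = f \<zeta> * w \<zeta>" for \<zeta>
      using q_nz[of \<zeta>] by (simp add: u_def)
    ultimately show ?thesis by simp
  qed
  have fW: "H1_function (\<lambda>\<zeta>. f \<zeta> * W n \<zeta>)" "H1_function (\<lambda>\<zeta>. f \<zeta> * cnj (W n \<zeta>))" for n
  proof -
    obtain C where C: "AE \<zeta> in circle_measure. norm (W n \<zeta>) \<le> C" using W_bdd by blast
    have "H2_function (W n)" by (rule H2_function_bounded[OF W1 C])
    moreover have "H2_function u" by (rule H2_function_bounded[OF u, of 1]) (simp add: u_norm)
    ultimately have "H1_function (\<lambda>\<zeta>. u \<zeta> * W n \<zeta>)" by (rule H1_function_mult[rotated])
    then show "H1_function (\<lambda>\<zeta>. f \<zeta> * W n \<zeta>)" using C by (rule mult)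
    show "H1_function (\<lambda>\<zeta>. f \<zeta> * cnj (W n \<zeta>))" using C by (intro mult[OF uW]) simp
  qed
  define N where "N = card K"
  define I where "I = {..N} \<times> (UNIV :: bool set)"
  define part :: "nat \<times> bool \<Rightarrow> complex \<Rightarrow> real"
    where "part i \<zeta> = (if snd i then Re (W (fst i) \<zeta>) else Im (W (fst i) \<zeta>))" for i \<zeta>
  have [measurable]: "part i \<in> borel_measurable circle_measure" for i
    unfolding part_def[abs_def] by measurable
  have fpart: "H1_function (\<lambda>\<zeta>. part i \<zeta> * f \<zeta>)" for i
  proof (cases "snd i")
    case True
    have "H1_function (\<lambda>\<zeta>. (1/2) * (f \<zeta> * W (fst i) \<zeta>) + (1/2) * (f \<zeta> * cnj (W (fst i) \<zeta>)))"
      by (intro H1_function_lincomb fW)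
    moreover have "(1/2) * (f \<zeta> * W (fst i) \<zeta>) + (1/2) * (f \<zeta> * cnj (W (fst i) \<zeta>)) = part i \<zeta> * f \<zeta>" for \<zeta>
      using True by (simp add: part_def complex_eq_iff field_simps)
    ultimately show ?thesis by simp
  next
    case False
    have "H1_function (\<lambda>\<zeta>. (- \<i> / 2) * (f \<zeta> * W (fst i) \<zeta>) + (\<i> / 2) * (f \<zeta> * cnj (W (fst i) \<zeta>)))"
      by (intro H1_function_lincomb fW)
    moreover have "(- \<i> / 2) * (f \<zeta> * W (fst i) \<zeta>) + (\<i> / 2) * (f \<zeta> * cnj (W (fst i) \<zeta>)) = part i \<zeta> * f \<zeta>" for \<zeta>
      using False by (simp add: part_def complex_eq_iff field_simps)
    ultimately show ?thesis by simp
  qed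
  define coef where "coef k i = (LINT \<zeta>|circle_measure. cnj \<zeta> powi k * (part i \<zeta> * f \<zeta>))" for k i
  define L where "L = (\<lambda>(k, b) i. if b then Re (coef k i) else Im (coef k i))"
  have "card (K \<times> (UNIV :: bool set)) < card I"
    by (simp add: I_def card_cartesian_product N_def)
  then obtain x where x: "\<exists>i\<in>I. x i \<noteq> 0" "\<And>k. k \<in> K \<times> UNIV \<Longrightarrow> (\<Sum>i\<in>I. x i * L k i) = 0"
    using nontrivial_real_solution_exists[of "K \<times> (UNIV :: bool set)" I L] K by (auto simp: I_def)
  define h where "h \<zeta> = (\<Sum>i\<in>I. x i * part i \<zeta>)" for \<zeta>
  have hf: "h \<zeta> * f \<zeta> = (\<Sum>i\<in>I. of_real (x i) * (part i \<zeta> * f \<zeta>))" for \<zeta>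
    by (simp add: h_def sum_distrib_right mult.assoc)
  obtain C where C: "\<And>n. AE \<zeta> in circle_measure. norm (W n \<zeta>) \<le> C n" using W_bdd by metis
  have "\<exists>c::real. AE \<zeta> in circle_measure. h \<zeta> = c"
  proof (rule const[of h "\<Sum>i\<in>I. \<bar>x i\<bar> * C (fst i)"])
    show "h \<in> borel_measurable circle_measure" unfolding h_def by measurable
    have "AE \<zeta> in circle_measure. \<forall>n. norm (W n \<zeta>) \<le> C n" using C by (simp add: AE_all_countable)
    then show "AE \<zeta> in circle_measure. \<bar>h \<zeta>\<bar> \<le> (\<Sum>i\<in>I. \<bar>x i\<bar> * C (fst i))"
    proof eventually_elim
      case (elim \<zeta>)
      have "\<bar>part i \<zeta>\<bar> \<le> C (fst i)" for i
        using abs_Re_le_cmod[of "W (fst i) \<zeta>"] abs_Im_le_cmod[of "W (fst i) \<zeta>"] elim[rule_format, of "fst i"]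
        by (auto simp: part_def)
      then have "(\<Sum>i\<in>I. \<bar>x i * part i \<zeta>\<bar>) \<le> (\<Sum>i\<in>I. \<bar>x i\<bar> * C (fst i))"
        by (intro sum_mono) (simp add: abs_mult mult_left_mono)
      then show ?case unfolding h_def using sum_abs[of "\<lambda>i. x i * part i \<zeta>" I] by linarith
    qed
    show "H1_function (\<lambda>\<zeta>. of_real (h \<zeta>) * f \<zeta>)" unfolding hf by (intro H1_function_sum fpart)
    fix k assume k: "k \<in> K"
    have "(LINT \<zeta>|circle_measure. cnj \<zeta> powi k * (of_real (h \<zeta>) * f \<zeta>)) =
        (LINT \<zeta>|circle_measure. (\<Sum>i\<in>I. of_real (x i) * (cnj \<zeta> powi k * (part i \<zeta> * f \<zeta>))))"
      unfolding hf by (simp add: sum_distrib_left mult.left_commute)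
    also have "\<dots> = (\<Sum>i\<in>I. of_real (x i) * coef k i)"
      unfolding coef_def
      using integrable_cnj_powi_mult[OF H1_function_integrable[OF fpart]]
      by (subst Bochner_Integration.integral_sum) simp_all
    also have "\<dots> = 0"
      using x(2)[of "(k, True)"] x(2)[of "(k, False)"] k
      by (simp add: complex_eq_iff L_def)
    finally show "(LINT \<zeta>|circle_measure. cnj \<zeta> powi k * (of_real (h \<zeta>) * f \<zeta>)) = 0" .
  qed
  then obtain c where c: "AE \<zeta> in circle_measure. h \<zeta> = c" ..
  \<comment> \<open>the real part of \<open>a n * W n\<close> is the contribution of \<open>W n\<close> to \<open>h\<close>\<close>
  define a where "a n = Complex (x (n, True)) (- x (n, False))" for n
  define Y where "Y \<zeta> = (\<Sum>n\<le>N. a n * W n \<zeta>)" for \<zeta>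
  have Re_Y: "Re (Y \<zeta>) = h \<zeta>" for \<zeta>
  proof -
    have "h \<zeta> = (\<Sum>n\<le>N. \<Sum>b\<in>UNIV. x (n, b) * part (n, b) \<zeta>)"
      unfolding h_def I_def by (subst sum.cartesian_product) (simp add: case_prod_unfold)
    also have "\<dots> = (\<Sum>n\<le>N. Re (a n * W n \<zeta>))"
      by (simp add: UNIV_bool part_def a_def add.commute)
    finally show ?thesis by (simp add: Y_def)
  qed
  have Y: "H1_function Y" unfolding Y_def by (intro H1_function_sum W1)
  note [measurable] = H1_function_measurable[OF Y]
  have "H1_function (\<lambda>\<zeta>. (- 1) * Y \<zeta> + of_real (2 * c) * 1)"
    by (intro H1_function_lincomb Y H1_function_const)
  then have "H1_function (\<lambda>\<zeta>. cnj (Y \<zeta>))"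
  proof (rule H1_function_cong_AE)
    show "AE \<zeta> in circle_measure. (- 1) * Y \<zeta> + of_real (2 * c) * 1 = cnj (Y \<zeta>)"
      using c by eventually_elim (simp add: complex_eq_iff Re_Y)
  qed measurable
  then have Y_const: "AE \<zeta> in circle_measure. Y \<zeta> = (LINT \<zeta>|circle_measure. Y \<zeta>)"
    by (rule AE_constant_if_coefficients_zero[OF Y])
  define d where "d = (LINT \<zeta>|circle_measure. Y \<zeta>)"
  obtain p where p: "\<And>n. AE \<zeta> in circle_measure. \<zeta> ^ n * W n \<zeta> = u \<zeta> - poly (p n) \<zeta>"
    using W_poly by metis
  then have "AE \<zeta> in circle_measure. \<forall>n. \<zeta> ^ n * W n \<zeta> = u \<zeta> - poly (p n) \<zeta>"
    by (simp add: AE_all_countable)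
  define t where "t = (\<Sum>n\<le>N. monom (a n) (N - n))"
  define P where "P = (\<Sum>n\<le>N. monom (a n) (N - n) * p n) + monom d N"
  have "AE \<zeta> in circle_measure. f \<zeta> * q \<zeta> * q \<zeta> * poly t \<zeta> = poly P \<zeta>"
    using \<open>AE \<zeta> in circle_measure. \<forall>n. \<zeta> ^ n * W n \<zeta> = u \<zeta> - poly (p n) \<zeta>\<close> Y_const
  proof eventually_elim
    case (elim \<zeta>)
    have "d * \<zeta> ^ N = (\<Sum>n\<le>N. a n * W n \<zeta>) * \<zeta> ^ N"
      using elim(2) by (simp add: Y_def d_def)
    also have "\<dots> = (\<Sum>n\<le>N. a n * \<zeta> ^ (N - n) * (\<zeta> ^ n * W n \<zeta>))"
      unfolding sum_distrib_right
    proof (rule sum.cong)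
      fix n assume "n \<in> {..N}"
      then have "\<zeta> ^ N = \<zeta> ^ (N - n) * \<zeta> ^ n" by (simp flip: power_add)
      then show "a n * W n \<zeta> * \<zeta> ^ N = a n * \<zeta> ^ (N - n) * (\<zeta> ^ n * W n \<zeta>)" by (simp only: mult_ac)
    qed simp
    also have "\<dots> = (\<Sum>n\<le>N. a n * \<zeta> ^ (N - n) * u \<zeta> - a n * \<zeta> ^ (N - n) * poly (p n) \<zeta>)"
      using elim(1) by (simp only: right_diff_distrib)
    also have "\<dots> = u \<zeta> * poly t \<zeta> - (\<Sum>n\<le>N. poly (monom (a n) (N - n) * p n) \<zeta>)"
      by (simp add: t_def poly_sum poly_monom sum_subtractf sum_distrib_left mult_ac)
    finally show ?case
      by (simp add: P_def poly_sum poly_monom flip: u_def)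
  qed
  moreover have "t \<noteq> 0"
  proof -
    obtain n b where nb: "n \<le> N" "x (n, b) \<noteq> 0" using x(1) by (auto simp: I_def)
    have "coeff t (N - n) = (\<Sum>m\<le>N. if m = n then a m else 0)"
      unfolding t_def coeff_sum using nb(1) by (intro sum.cong) (auto simp: coeff_monom)
    also have "\<dots> = a n" using nb(1) by simp
    finally show ?thesis using nb(2) by (cases b) (auto simp: a_def complex_eq_iff)
  qed
  ultimately show ?thesis by blast
qed

section \<open>Integrable functions and their classes\<close>

lemma circle_L1_representative:
  obtains F where "integrable circle_measure F" "f = abs_circle_L1 F"
proof
  show "integrable circle_measure (rep_circle_L1 f)"
    using Quotient_rep_reflp[OF Quotient_circle_L1, of f] by simp
  show "f = abs_circle_L1 (rep_circle_L1 f)"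
    using Quotient_abs_rep[OF Quotient_circle_L1, of f] by simp
qed

lemma abs_circle_L1_eq_iff:
  assumes "integrable circle_measure F" "integrable circle_measure G"
  shows "abs_circle_L1 F = abs_circle_L1 G \<longleftrightarrow> (AE \<zeta> in circle_measure. F \<zeta> = G \<zeta>)"
  using Quotient_rel[OF Quotient_circle_L1, of F G] assms by auto

lemma norm_abs_circle_L1:
  "integrable circle_measure F \<Longrightarrow> norm (abs_circle_L1 F) = (LINT \<zeta>|circle_measure. norm (F \<zeta>))"
  by (rule norm_circle_L1.abs_eq) simp

lemma fourier_coeff_abs_circle_L1:
  "integrable circle_measure F \<Longrightarrow>
    fourier_coeff (abs_circle_L1 F) k = (LINT \<zeta>|circle_measure. cnj \<zeta> powi k * F \<zeta>)"
  by (subst fourier_coeff.abs_eq) simp_all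

lemma mem_punctured_H1_iff:
  assumes F: "integrable circle_measure F"
  shows "abs_circle_L1 F \<in> punctured_H1 K \<longleftrightarrow>
    H1_function F \<and> (\<forall>k\<in>K. (LINT \<zeta>|circle_measure. cnj \<zeta> powi k * F \<zeta>) = 0)"
proof -
  note [measurable] = borel_measurable_integrable[OF F]
  have eq: "(LINT \<zeta>|circle_measure. cnj \<zeta> powi (- int (Suc n)) * F \<zeta>) = (LINT \<zeta>|circle_measure. \<zeta> ^ Suc n * F \<zeta>)" for n
  proof (rule integral_cong_AE)
    show "(\<lambda>\<zeta>. cnj \<zeta> powi (- int (Suc n)) * F \<zeta>) \<in> borel_measurable circle_measure"
      using borel_measurable_integrable[OF integrable_cnj_powi_mult[OF F]] .
    show "AE \<zeta> in circle_measure. cnj \<zeta> powi (- int (Suc n)) * F \<zeta> = \<zeta> ^ Suc n * F \<zeta>"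
      using AE_circle_measure_mult_cnj
    proof eventually_elim
      case (elim \<zeta>)
      then have "inverse (cnj \<zeta>) = \<zeta>" by (metis inverse_unique mult.commute)
      then have "cnj \<zeta> powi (- int (Suc n)) = \<zeta> ^ Suc n"
        by (simp only: power_int_minus power_int_of_nat power_inverse[symmetric])
      then show ?case by (simp only:)
    qed
  qed measurable
  have "(\<forall>k<0. fourier_coeff (abs_circle_L1 F) k = 0) \<longleftrightarrow>
      (\<forall>n. fourier_coeff (abs_circle_L1 F) (- int (Suc n)) = 0)"
  proof (intro iffI allI impI)
    fix k :: int
    assume *: "\<forall>n. fourier_coeff (abs_circle_L1 F) (- int (Suc n)) = 0" and "k < 0"
    then obtain n where k: "k = - int (Suc n)" using negD by blast
    show "fourier_coeff (abs_circle_L1 F) k = 0" unfolding k using * by blast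
  qed simp
  then show ?thesis
    using F by (simp only: punctured_H1_def hardy_H1_def mem_Collect_eq fourier_coeff_abs_circle_L1 eq H1_function_def simp_thms)
qed

section \<open>Multiples of an extreme point\<close>

text \<open>The case of equality in the triangle inequality for integrals.\<close>

lemma AE_eq_if_integral_norm_le_pairing:
  assumes X: "integrable circle_measure X" and f: "f \<in> borel_measurable circle_measure"
    and le: "(LINT \<zeta>|circle_measure. norm (X \<zeta>)) \<le> 1"
    and eq: "(LINT \<zeta>|circle_measure. cnj (sgn (f \<zeta>)) * X \<zeta>) = 1"
  shows "AE \<zeta> in circle_measure. cnj (sgn (f \<zeta>)) * X \<zeta> = norm (X \<zeta>)"
proof -
  note [measurable] = borel_measurable_integrable[OF X] f
  have sgn: "norm (cnj (sgn (f \<zeta>))) \<le> 1" for \<zeta> by (simp add: norm_sgn)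
  have sgn_meas: "(\<lambda>\<zeta>. cnj (sgn (f \<zeta>))) \<in> borel_measurable circle_measure"
    unfolding sgn_div_norm by measurable
  have int: "integrable circle_measure (\<lambda>\<zeta>. cnj (sgn (f \<zeta>)) * X \<zeta>)"
    by (rule integrable_mult_bounded[OF sgn_meas X AE_I2[OF sgn]])
  have norm_le: "norm (cnj (sgn (f \<zeta>)) * X \<zeta>) \<le> norm (X \<zeta>)" for \<zeta>
    unfolding norm_mult using mult_right_mono[OF sgn norm_ge_zero] by simp
  have Re_le: "Re (cnj (sgn (f \<zeta>)) * X \<zeta>) \<le> norm (X \<zeta>)" for \<zeta>
    using complex_Re_le_cmod norm_le by (rule order_trans)
  define D where "D \<zeta> = norm (X \<zeta>) - Re (cnj (sgn (f \<zeta>)) * X \<zeta>)" for \<zeta>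
  have D: "integrable circle_measure D" "0 \<le> D \<zeta>" for \<zeta>
    unfolding D_def[abs_def] using X integrable_Re[OF int] Re_le[of \<zeta>]
    by (auto simp del: times_complex.sel)
  have "(LINT \<zeta>|circle_measure. D \<zeta>) = (LINT \<zeta>|circle_measure. norm (X \<zeta>)) - 1"
    unfolding D_def using X integrable_Re[OF int] integral_Re[OF int] eq
    by (simp del: times_complex.sel)
  then have "(LINT \<zeta>|circle_measure. D \<zeta>) = 0"
    using le Bochner_Integration.integral_nonneg[of circle_measure D, OF D(2)] by linarith
  then have "AE \<zeta> in circle_measure. D \<zeta> = 0"
    using D by (subst (asm) integral_nonneg_eq_0_iff_AE) auto
  then show ?thesis
  proof eventually_elim
    case (elim \<zeta>)
    define z where "z = cnj (sgn (f \<zeta>)) * X \<zeta>"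
    have Re: "Re z = norm (X \<zeta>)" using elim by (simp only: D_def z_def)
    have "(norm z)\<^sup>2 \<le> (norm (X \<zeta>))\<^sup>2" using norm_le[of \<zeta>] by (intro power_mono) (simp_all add: z_def)
    then have "(Im z)\<^sup>2 \<le> 0" unfolding cmod_power2 Re by simp
    then show ?case unfolding z_def[symmetric] using Re by (simp add: complex_eq_iff)
  qed
qed

text \<open>With \<open>c\<close> the mean of \<open>h\<close> for the probability density \<open>|f|\<close>, the functions
  \<open>G s = (1 + s e (h - c)) f\<close> for \<open>s = 1\<close> and \<open>s = -1\<close> have the midpoint \<open>f\<close>. For small \<open>e\<close> the
  factor is nonnegative, so their norm is 1 by the choice of \<open>c\<close>, and extremality makes them
  equal.\<close>

lemma bounded_multiplier_constant:
  assumes ext: "abs_circle_L1 f extreme_point_of unit_ball_of (punctured_H1 K)"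
    and f: "integrable circle_measure f" and nz: "\<And>\<zeta>. f \<zeta> \<noteq> 0"
    and f_norm: "(LINT \<zeta>|circle_measure. norm (f \<zeta>)) = 1"
    and h: "h \<in> borel_measurable circle_measure" and bd: "AE \<zeta> in circle_measure. \<bar>h \<zeta>\<bar> \<le> B"
    and hf: "abs_circle_L1 (\<lambda>\<zeta>. complex_of_real (h \<zeta>) * f \<zeta>) \<in> punctured_H1 K"
  shows "AE \<zeta> in circle_measure. h \<zeta> = (LINT \<zeta>|circle_measure. h \<zeta> * norm (f \<zeta>))"
proof -
  note [measurable] = borel_measurable_integrable[OF f] h
  define c where "c = (LINT \<zeta>|circle_measure. h \<zeta> * norm (f \<zeta>))"
  have int: "integrable circle_measure (\<lambda>\<zeta>. complex_of_real (h \<zeta>) * f \<zeta>)"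
    by (intro integrable_mult_bounded[where C = B] f) (measurable, use bd in simp)
  have int': "integrable circle_measure (\<lambda>\<zeta>. h \<zeta> * norm (f \<zeta>))"
  proof (rule Bochner_Integration.integrable_bound[OF int])
    show "AE \<zeta> in circle_measure. norm (h \<zeta> * norm (f \<zeta>)) \<le> norm (complex_of_real (h \<zeta>) * f \<zeta>)"
      by (simp add: norm_mult abs_mult)
  qed measurable
  have "abs_circle_L1 f \<in> punctured_H1 K"
    using ext by (auto simp: extreme_point_of_def unit_ball_of_def)
  then have fP: "H1_function f" "\<And>k. k \<in> K \<Longrightarrow> (LINT \<zeta>|circle_measure. cnj \<zeta> powi k * f \<zeta>) = 0"
    unfolding mem_punctured_H1_iff[OF f] by blast+
  have hP: "H1_function (\<lambda>\<zeta>. complex_of_real (h \<zeta>) * f \<zeta>)"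
    "\<And>k. k \<in> K \<Longrightarrow> (LINT \<zeta>|circle_measure. cnj \<zeta> powi k * (complex_of_real (h \<zeta>) * f \<zeta>)) = 0"
    using hf unfolding mem_punctured_H1_iff[OF int] by blast+
  define e where "e = 1 / (\<bar>B\<bar> + \<bar>c\<bar> + 1)"
  have e: "0 < e" by (simp add: e_def)
  have small: "AE \<zeta> in circle_measure. \<bar>e * (h \<zeta> - c)\<bar> \<le> 1"
    using bd
  proof eventually_elim
    case (elim \<zeta>)
    then have "\<bar>h \<zeta> - c\<bar> \<le> \<bar>B\<bar> + \<bar>c\<bar> + 1" by linarith
    then have "e * \<bar>h \<zeta> - c\<bar> \<le> e * (\<bar>B\<bar> + \<bar>c\<bar> + 1)" using e by (intro mult_left_mono) simp_all
    also have "e * (\<bar>B\<bar> + \<bar>c\<bar> + 1) = 1" by (simp add: e_def)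
    finally show ?case using e by (simp add: abs_mult)
  qed
  define G where "G s \<zeta> = of_real (1 + s * e * (h \<zeta> - c)) * f \<zeta>" for s \<zeta>
  have G_eq: "G s \<zeta> = of_real (1 - s * e * c) * f \<zeta> + of_real (s * e) * (of_real (h \<zeta>) * f \<zeta>)" for s \<zeta>
    by (simp add: G_def algebra_simps)
  have G_int: "integrable circle_measure (G s)" for s
    unfolding G_eq[abs_def] by (intro Bochner_Integration.integrable_add integrable_mult_right f int)
  have G_ball: "abs_circle_L1 (G s) \<in> unit_ball_of (punctured_H1 K)" if s: "\<bar>s\<bar> = 1" for s
  proof -
    have "H1_function (G s)"
      unfolding G_eq[abs_def] by (intro H1_function_lincomb fP hP)
    moreover have "(LINT \<zeta>|circle_measure. cnj \<zeta> powi k * G s \<zeta>) = 0" if k: "k \<in> K" for k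
    proof -
      have eq: "cnj \<zeta> powi k * G s \<zeta> = of_real (1 - s * e * c) * (cnj \<zeta> powi k * f \<zeta>)
          + of_real (s * e) * (cnj \<zeta> powi k * (of_real (h \<zeta>) * f \<zeta>))" for \<zeta>
        unfolding G_eq by (simp only: distrib_left mult.left_commute)
      have "(LINT \<zeta>|circle_measure. cnj \<zeta> powi k * G s \<zeta>) =
          of_real (1 - s * e * c) * (LINT \<zeta>|circle_measure. cnj \<zeta> powi k * f \<zeta>)
          + of_real (s * e) * (LINT \<zeta>|circle_measure. cnj \<zeta> powi k * (of_real (h \<zeta>) * f \<zeta>))"
        unfolding eq
        using integrable_cnj_powi_mult[OF f, of k] integrable_cnj_powi_mult[OF int, of k]
        by (simp only: Bochner_Integration.integral_add integrable_mult_right integral_mult_right_zero)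
      then show ?thesis using fP(2)[OF k] hP(2)[OF k] by (simp only: mult_zero_right add_0)
    qed
    ultimately have "abs_circle_L1 (G s) \<in> punctured_H1 K"
      using G_int by (simp add: mem_punctured_H1_iff)
    moreover have "norm (abs_circle_L1 (G s)) = 1"
    proof -
      have "(LINT \<zeta>|circle_measure. norm (G s \<zeta>)) =
          (LINT \<zeta>|circle_measure. (1 - s * e * c) * norm (f \<zeta>) + s * e * (h \<zeta> * norm (f \<zeta>)))"
      proof (rule integral_cong_AE)
        show "AE \<zeta> in circle_measure. norm (G s \<zeta>) = (1 - s * e * c) * norm (f \<zeta>) + s * e * (h \<zeta> * norm (f \<zeta>))"
          using small
        proof eventually_elim
          case (elim \<zeta>)
          have "\<bar>s * (e * (h \<zeta> - c))\<bar> \<le> 1" using elim s by (simp only: abs_mult mult_1_left)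
          then have "0 \<le> 1 + s * e * (h \<zeta> - c)" by (simp add: mult.assoc)
          then have "norm (G s \<zeta>) = (1 + s * e * (h \<zeta> - c)) * norm (f \<zeta>)"
            by (simp only: G_def norm_mult norm_of_real abs_of_nonneg)
          then show ?case by (simp add: algebra_simps)
        qed
        show "(\<lambda>\<zeta>. norm (G s \<zeta>)) \<in> borel_measurable circle_measure"
          using borel_measurable_integrable[OF G_int] by measurable
      qed measurable
      also have "\<dots> = (1 - s * e * c) * 1 + s * e * c"
        using f int' by (simp add: f_norm c_def)
      finally show ?thesis by (simp add: norm_abs_circle_L1[OF G_int])
    qed
    ultimately show ?thesis by (simp add: unit_ball_of_def)
  qed
  have mid: "abs_circle_L1 f = (1 - 1/2) *\<^sub>R abs_circle_L1 (G (- 1)) + (1/2) *\<^sub>R abs_circle_L1 (G 1)"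
  proof -
    have "(1 - 1/2) *\<^sub>R abs_circle_L1 (G (- 1)) + (1/2) *\<^sub>R abs_circle_L1 (G 1) =
        abs_circle_L1 (\<lambda>\<zeta>. (1 - 1/2) *\<^sub>R G (- 1) \<zeta> + (1/2) *\<^sub>R G 1 \<zeta>)"
      using G_int by (simp add: scaleR_circle_L1.abs_eq plus_circle_L1.abs_eq)
    also have "(\<lambda>\<zeta>. (1 - 1/2) *\<^sub>R G (- 1) \<zeta> + (1/2) *\<^sub>R G 1 \<zeta>) = f"
      by (simp add: fun_eq_iff G_def scaleR_conv_of_real algebra_simps)
    finally show ?thesis by simp
  qed
  have "abs_circle_L1 (G (- 1)) = abs_circle_L1 (G 1)"
  proof (rule ccontr)
    assume "abs_circle_L1 (G (- 1)) \<noteq> abs_circle_L1 (G 1)"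
    then have "abs_circle_L1 f \<in> open_segment (abs_circle_L1 (G (- 1))) (abs_circle_L1 (G 1))"
      using mid unfolding in_segment by (intro conjI exI[of _ "1/2"]) simp_all
    then show False using ext G_ball[of 1] G_ball[of "- 1"] by (simp add: extreme_point_of_def)
  qed
  then have "AE \<zeta> in circle_measure. G (- 1) \<zeta> = G 1 \<zeta>"
    using abs_circle_L1_eq_iff[OF G_int G_int] by blast
  then have "AE \<zeta> in circle_measure. h \<zeta> = c"
  proof eventually_elim
    case (elim \<zeta>)
    then have "complex_of_real (1 + (- 1) * e * (h \<zeta> - c)) = of_real (1 + 1 * e * (h \<zeta> - c))"
      using nz[of \<zeta>] by (simp only: G_def mult_cancel_right) simp
    then have "e * (h \<zeta> - c) = 0" unfolding of_real_eq_iff by simp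
    then show ?case using e by simp
  qed
  then show ?thesis by (simp only: c_def)
qed

lemma extreme_point_of_ball_norm:
  assumes ext: "f extreme_point_of unit_ball_of (punctured_H1 K)" and "f \<noteq> 0"
  shows "norm f = 1"
proof (rule ccontr)
  have f: "f \<in> punctured_H1 K" "norm f \<le> 1"
    using ext by (auto simp: extreme_point_of_def unit_ball_of_def)
  assume "norm f \<noteq> 1"
  with f assms(2) have n: "0 < norm f" "norm f < 1" by auto
  obtain F where F: "integrable circle_measure F" "f = abs_circle_L1 F" by (rule circle_L1_representative)
  have scale: "r *\<^sub>R f \<in> punctured_H1 K" for r
  proof -
    have int: "integrable circle_measure (\<lambda>\<zeta>. r *\<^sub>R F \<zeta>)" using F(1) by simp
    have FP: "H1_function F" "\<And>k. k \<in> K \<Longrightarrow> (LINT \<zeta>|circle_measure. cnj \<zeta> powi k * F \<zeta>) = 0"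
      using f(1) unfolding F(2) mem_punctured_H1_iff[OF F(1)] by blast+
    have eq: "cnj \<zeta> powi k * (r *\<^sub>R F \<zeta>) = r *\<^sub>R (cnj \<zeta> powi k * F \<zeta>)" for k \<zeta>
      by (simp only: mult_scaleR_right)
    have "(LINT \<zeta>|circle_measure. cnj \<zeta> powi k * (r *\<^sub>R F \<zeta>)) = 0" if "k \<in> K" for k
      unfolding eq using FP(2)[OF that] by simp
    moreover have "H1_function (\<lambda>\<zeta>. r *\<^sub>R F \<zeta>)"
      using H1_function_cmult[OF FP(1), of "of_real r"] by (simp only: scaleR_conv_of_real)
    ultimately have "abs_circle_L1 (\<lambda>\<zeta>. r *\<^sub>R F \<zeta>) \<in> punctured_H1 K"
      unfolding mem_punctured_H1_iff[OF int] by blast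
    moreover have "r *\<^sub>R f = abs_circle_L1 (\<lambda>\<zeta>. r *\<^sub>R F \<zeta>)"
      unfolding F(2) by (rule scaleR_circle_L1.abs_eq) (use F(1) in simp)
    ultimately show ?thesis by simp
  qed
  define g where "g = (1 / norm f) *\<^sub>R f"
  have "g \<in> unit_ball_of (punctured_H1 K)" "0 \<in> unit_ball_of (punctured_H1 K)"
    using scale[of "1 / norm f"] scale[of 0] n by (simp_all add: unit_ball_of_def g_def)
  moreover have "f \<in> open_segment 0 g"
    using n assms(2) unfolding in_segment by (intro conjI exI[of _ "norm f"]) (simp_all add: g_def)
  ultimately show False using ext by (simp add: extreme_point_of_def)
qed

text \<open>Replacing \<open>h\<close> by \<open>1 + h\<close> makes the reciprocal of the multiple \<open>g\<close> integrable, so that \<open>g\<close> has an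
  outer factor as well. The quotient \<open>W\<close> of the two factors satisfies \<open>|W|\<^sup>2 = 1 + h\<close>, and
  \<open>u cnj W\<close> is analytic because \<open>u cnj W W = u (1 + h) = g q\<^sup>2 = (g s q) W\<close>.\<close>

lemma positive_multiple_bounded:
  fixes f :: "complex \<Rightarrow> complex" and h :: "complex \<Rightarrow> real"
  assumes f: "H1_function f" and nz: "\<And>\<zeta>. f \<zeta> \<noteq> 0" and inv: "integrable circle_measure (\<lambda>\<zeta>. 1 / f \<zeta>)"
    and q: "H2_function q" "H2_function (\<lambda>\<zeta>. f \<zeta> * q \<zeta>)" "\<And>\<zeta>. (norm (q \<zeta>))\<^sup>2 * norm (f \<zeta>) = 1"
    and rat: "\<exists>t p. t \<noteq> 0 \<and> (AE \<zeta> in circle_measure. f \<zeta> * q \<zeta> * q \<zeta> * poly t \<zeta> = poly p \<zeta>)"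
    and h: "h \<in> borel_measurable circle_measure" "\<And>\<zeta>. 0 \<le> h \<zeta>"
    and hf: "H1_function (\<lambda>\<zeta>. of_real (h \<zeta>) * f \<zeta>)"
  shows "\<exists>C. AE \<zeta> in circle_measure. \<bar>h \<zeta>\<bar> \<le> C"
proof -
  note [measurable] = H1_function_measurable[OF f] h(1)
  define g where "g \<zeta> = of_real (1 + h \<zeta>) * f \<zeta>" for \<zeta>
  have g1: "H1_function g"
    using H1_function_lincomb[OF f hf, of 1 1] by (simp add: g_def[abs_def] algebra_simps)
  note [measurable] = H1_function_measurable[OF g1]
  have pos: "0 < 1 + h \<zeta>" for \<zeta> using h(2)[of \<zeta>] by linarith
  have g_nz: "g \<zeta> \<noteq> 0" for \<zeta>
    unfolding g_def mult_eq_0_iff of_real_eq_0_iff using nz[of \<zeta>] pos[of \<zeta>] by simp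
  have g_norm: "norm (g \<zeta>) = (1 + h \<zeta>) * norm (f \<zeta>)" for \<zeta>
    using pos[of \<zeta>] by (simp only: g_def norm_mult norm_of_real abs_of_pos)
  have "integrable circle_measure (\<lambda>\<zeta>. 1 / g \<zeta>)"
  proof (rule Bochner_Integration.integrable_bound[OF inv])
    have "norm (f \<zeta>) \<le> norm (g \<zeta>)" for \<zeta>
      unfolding g_norm using mult_right_mono[of 1 "1 + h \<zeta>" "norm (f \<zeta>)"] h(2)[of \<zeta>] by simp
    then show "AE \<zeta> in circle_measure. norm (1 / g \<zeta>) \<le> norm (1 / f \<zeta>)"
      using nz by (simp add: norm_divide frac_le)
  qed measurable
  from outer_factor_exists[OF g1 g_nz this]
  obtain s where s: "H2_function (\<lambda>\<zeta>. 1 / s \<zeta>)" "H2_function (\<lambda>\<zeta>. g \<zeta> * s \<zeta>)"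
      "\<And>\<zeta>. (norm (s \<zeta>))\<^sup>2 * norm (g \<zeta>) = 1" by metis
  have s_nz: "s \<zeta> \<noteq> 0" for \<zeta> using s(3)[of \<zeta>] by auto
  define u where "u \<zeta> = f \<zeta> * q \<zeta> * q \<zeta>" for \<zeta>
  have u_norm: "norm (u \<zeta>) = 1" for \<zeta>
  proof -
    have "norm (u \<zeta>) = (norm (q \<zeta>))\<^sup>2 * norm (f \<zeta>)"
      by (simp add: u_def norm_mult power2_eq_square)
    then show ?thesis by (simp only: q(3))
  qed
  define W where "W \<zeta> = q \<zeta> * (1 / s \<zeta>)" for \<zeta>
  have W: "H1_function W" unfolding W_def by (rule H1_function_mult[OF q(1) s(1)])
  have W_norm: "(norm (W \<zeta>))\<^sup>2 = 1 + h \<zeta>" for \<zeta>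
  proof -
    have "(norm (W \<zeta>))\<^sup>2 * ((norm (s \<zeta>))\<^sup>2 * norm (g \<zeta>)) = (norm (q \<zeta>))\<^sup>2 * norm (g \<zeta>)"
      using s_nz[of \<zeta>] by (simp add: W_def norm_mult norm_divide power_divide power_mult_distrib)
    also have "\<dots> = (1 + h \<zeta>) * ((norm (q \<zeta>))\<^sup>2 * norm (f \<zeta>))" unfolding g_norm by simp
    finally show ?thesis by (simp only: s(3) q(3) mult_1_right)
  qed
  have "u \<zeta> * cnj (W \<zeta>) = g \<zeta> * s \<zeta> * q \<zeta>" for \<zeta>
  proof -
    have "W \<zeta> * cnj (W \<zeta>) = of_real (1 + h \<zeta>)"
      unfolding complex_norm_square[symmetric] W_norm ..
    then have "u \<zeta> * cnj (W \<zeta>) * W \<zeta> = u \<zeta> * of_real (1 + h \<zeta>)"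
      by (simp only: mult.assoc mult.commute[of "cnj (W \<zeta>)"])
    also have "\<dots> = g \<zeta> * s \<zeta> * q \<zeta> * W \<zeta>"
      using s_nz[of \<zeta>] by (simp add: u_def g_def W_def)
    finally have "u \<zeta> * cnj (W \<zeta>) * W \<zeta> = g \<zeta> * s \<zeta> * q \<zeta> * W \<zeta>" .
    moreover have "W \<zeta> \<noteq> 0" using W_norm[of \<zeta>] pos[of \<zeta>] by auto
    ultimately show ?thesis by (simp only: mult_cancel_right) simp
  qed
  then have uW: "H1_function (\<lambda>\<zeta>. u \<zeta> * cnj (W \<zeta>))"
    using H1_function_mult[OF s(2) q(1)] by simp
  have "AE \<zeta> in circle_measure. norm (u \<zeta>) = 1" by (simp add: u_norm)
  moreover have "\<exists>t p. t \<noteq> 0 \<and> (AE \<zeta> in circle_measure. u \<zeta> * poly t \<zeta> = poly p \<zeta>)"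
    using rat unfolding u_def .
  ultimately obtain t p where "AE \<zeta> in circle_measure. u \<zeta> * poly t \<zeta> = poly p \<zeta>" "\<And>\<zeta>. norm \<zeta> = 1 \<Longrightarrow> poly p \<zeta> \<noteq> 0"
    using rational_symbol_without_zeros by blast
  from AE_bounded_if_rational_symbol[OF uW W this]
  obtain C where C: "AE \<zeta> in circle_measure. norm (W \<zeta>) \<le> C" ..
  have "AE \<zeta> in circle_measure. \<bar>h \<zeta>\<bar> \<le> C\<^sup>2"
    using C
  proof eventually_elim
    case (elim \<zeta>)
    have "(norm (W \<zeta>))\<^sup>2 \<le> C\<^sup>2" using elim by (intro power_mono) auto
    then show ?case using W_norm[of \<zeta>] h(2)[of \<zeta>] by linarith
  qed
  then show ?thesis ..
qed

lemma positive_multiple_of_extreme_point: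
  fixes f :: "complex \<Rightarrow> complex" and h :: "complex \<Rightarrow> real"
  assumes K: "finite K"
    and ext: "abs_circle_L1 f extreme_point_of unit_ball_of (punctured_H1 K)"
    and f: "integrable circle_measure f" and nz: "\<And>\<zeta>. f \<zeta> \<noteq> 0"
    and f_norm: "(LINT \<zeta>|circle_measure. norm (f \<zeta>)) = 1"
    and inv: "integrable circle_measure (\<lambda>\<zeta>. 1 / f \<zeta>)"
    and h: "h \<in> borel_measurable circle_measure" "\<And>\<zeta>. 0 \<le> h \<zeta>"
    and int: "integrable circle_measure (\<lambda>\<zeta>. of_real (h \<zeta>) * f \<zeta>)"
    and hf: "abs_circle_L1 (\<lambda>\<zeta>. of_real (h \<zeta>) * f \<zeta>) \<in> punctured_H1 K"
  shows "AE \<zeta> in circle_measure. h \<zeta> = (LINT \<zeta>|circle_measure. h \<zeta> * norm (f \<zeta>))"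
proof -
  have "abs_circle_L1 f \<in> punctured_H1 K"
    using ext by (auto simp: extreme_point_of_def unit_ball_of_def)
  then have f1: "H1_function f" using f by (simp add: mem_punctured_H1_iff)
  have hf1: "H1_function (\<lambda>\<zeta>. of_real (h \<zeta>) * f \<zeta>)" using hf int by (simp add: mem_punctured_H1_iff)
  obtain q where q: "H2_function q" "H2_function (\<lambda>\<zeta>. 1 / q \<zeta>)" "H2_function (\<lambda>\<zeta>. f \<zeta> * q \<zeta>)"
    "\<And>\<zeta>. (norm (q \<zeta>))\<^sup>2 * norm (f \<zeta>) = 1"
    using outer_factor_exists[OF f1 nz inv] by metis
  have rat: "\<exists>t p. t \<noteq> 0 \<and> (AE \<zeta> in circle_measure. f \<zeta> * q \<zeta> * q \<zeta> * poly t \<zeta> = poly p \<zeta>)"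
  proof (rule rational_symbol_if_bounded_multipliers_constant[OF K f q])
    fix k :: "complex \<Rightarrow> real" and B :: real
    assume k: "k \<in> borel_measurable circle_measure" "AE \<zeta> in circle_measure. \<bar>k \<zeta>\<bar> \<le> B"
      "H1_function (\<lambda>\<zeta>. of_real (k \<zeta>) * f \<zeta>)"
      "\<And>j. j \<in> K \<Longrightarrow> (LINT \<zeta>|circle_measure. cnj \<zeta> powi j * (of_real (k \<zeta>) * f \<zeta>)) = 0"
    then have "abs_circle_L1 (\<lambda>\<zeta>. of_real (k \<zeta>) * f \<zeta>) \<in> punctured_H1 K"
      using mem_punctured_H1_iff[OF H1_function_integrable[OF k(3)], of K] by blast
    from bounded_multiplier_constant[OF ext f nz f_norm k(1,2) this]
    show "\<exists>c::real. AE \<zeta> in circle_measure. k \<zeta> = c" ..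
  qed
  obtain C where "AE \<zeta> in circle_measure. \<bar>h \<zeta>\<bar> \<le> C"
    using positive_multiple_bounded[OF f1 nz inv q(1,3,4) rat h hf1] ..
  from bounded_multiplier_constant[OF ext f nz f_norm h(1) this hf] show ?thesis .
qed

section \<open>Exposed points\<close>

theorem theorem1p2:
  fixes K :: "int set" and f :: circle_L1
  assumes "finite K" and "\<forall>k\<in>K. 0 < k"
    and "f extreme_point_of unit_ball_of (punctured_H1 K)"
    and "reciprocal_in_L1 f"
  shows "exposed_point_of_ball f (punctured_H1 K)"
proof -
  obtain F0 where F0: "integrable circle_measure F0" "f = abs_circle_L1 F0"
    by (rule circle_L1_representative)
  have rec: "AE \<zeta> in circle_measure. F0 \<zeta> \<noteq> 0" "integrable circle_measure (\<lambda>\<zeta>. 1 / F0 \<zeta>)"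
    using assms(4) F0 by (simp_all add: reciprocal_in_L1.abs_eq)
  \<comment> \<open>a representative without zeros\<close>
  define F where "F \<zeta> = (if F0 \<zeta> = 0 then 1 else F0 \<zeta>)" for \<zeta>
  note [measurable] = borel_measurable_integrable[OF F0(1)]
  have [measurable]: "F \<in> borel_measurable circle_measure" unfolding F_def[abs_def] by measurable
  have F0_F: "AE \<zeta> in circle_measure. F0 \<zeta> = F \<zeta>" using rec(1) by eventually_elim (simp add: F_def)
  have F: "integrable circle_measure F"
    using F0(1) by (rule integrable_cong_AE_imp) (use F0_F in auto)
  have fF: "f = abs_circle_L1 F" using F0 F F0_F by (simp add: abs_circle_L1_eq_iff)
  have nz: "F \<zeta> \<noteq> 0" for \<zeta> by (simp add: F_def)
  have inv: "integrable circle_measure (\<lambda>\<zeta>. 1 / F \<zeta>)"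
    using rec(2) by (rule integrable_cong_AE_imp) (use F0_F in \<open>auto elim: eventually_mono\<close>)
  have f_ball: "f \<in> unit_ball_of (punctured_H1 K)"
    using assms(3) by (simp add: extreme_point_of_def)
  have "f \<noteq> 0"
  proof
    assume "f = 0"
    then have "abs_circle_L1 F = abs_circle_L1 (\<lambda>_. 0)" using fF by (simp add: zero_circle_L1_def)
    then have "AE \<zeta> in circle_measure. False"
      using F nz by (simp add: abs_circle_L1_eq_iff)
    then have "(LINT \<zeta>|circle_measure. (1 :: complex)) = (LINT \<zeta>|circle_measure. 0)"
      by (intro integral_cong_AE) auto
    then show False by simp
  qed
  then have norm_f: "norm f = 1" by (rule extreme_point_of_ball_norm[OF assms(3)])
  then have norm_F: "(LINT \<zeta>|circle_measure. norm (F \<zeta>)) = 1" using F fF by (simp add: norm_abs_circle_L1)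
  define w where "w \<zeta> = cnj (sgn (F \<zeta>))" for \<zeta>
  have [measurable]: "w \<in> borel_measurable circle_measure"
    unfolding w_def[abs_def] sgn_div_norm by measurable
  have w_norm: "norm (w \<zeta>) = 1" for \<zeta> using nz[of \<zeta>] by (simp add: w_def norm_sgn)
  have wX: "integrable circle_measure (\<lambda>\<zeta>. w \<zeta> * X \<zeta>)" if "integrable circle_measure X" for X
    using that by (intro integrable_mult_bounded[where C = 1]) (simp_all add: w_norm)
  define \<phi> where "\<phi> x = (LINT \<zeta>|circle_measure. w \<zeta> * rep_circle_L1 x \<zeta>)" for x
  have \<phi>: "\<phi> (abs_circle_L1 X) = (LINT \<zeta>|circle_measure. w \<zeta> * X \<zeta>)" if X: "integrable circle_measure X" for X
  proof -
    have R: "integrable circle_measure (rep_circle_L1 (abs_circle_L1 X))"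
      using Quotient_rep_reflp[OF Quotient_circle_L1, of "abs_circle_L1 X"] by simp
    have "abs_circle_L1 (rep_circle_L1 (abs_circle_L1 X)) = abs_circle_L1 X"
      by (rule Quotient_abs_rep[OF Quotient_circle_L1])
    then have "AE \<zeta> in circle_measure. rep_circle_L1 (abs_circle_L1 X) \<zeta> = X \<zeta>"
      using abs_circle_L1_eq_iff[OF R X] by simp
    then show ?thesis
      unfolding \<phi>_def
      using borel_measurable_integrable[OF wX[OF R]] borel_measurable_integrable[OF wX[OF X]]
      by (intro integral_cong_AE) (auto elim: eventually_mono)
  qed
  have \<phi>_bound: "norm (\<phi> x) \<le> norm x" for x
  proof -
    obtain X where X: "integrable circle_measure X" "x = abs_circle_L1 X" by (rule circle_L1_representative)
    have "norm (\<phi> x) \<le> (LINT \<zeta>|circle_measure. norm (w \<zeta> * X \<zeta>))"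
      unfolding X(2) \<phi>[OF X(1)] by (rule integral_norm_bound)
    also have "\<dots> = norm x" unfolding X(2) norm_abs_circle_L1[OF X(1)] by (simp add: norm_mult w_norm)
    finally show ?thesis .
  qed
  have \<phi>_add: "\<phi> (x + y) = \<phi> x + \<phi> y" for x y
  proof -
    obtain X where X: "integrable circle_measure X" "x = abs_circle_L1 X" by (rule circle_L1_representative)
    obtain Y where Y: "integrable circle_measure Y" "y = abs_circle_L1 Y" by (rule circle_L1_representative)
    have "x + y = abs_circle_L1 (\<lambda>\<zeta>. X \<zeta> + Y \<zeta>)" using X Y by (simp add: plus_circle_L1.abs_eq)
    then show ?thesis using X Y wX by (simp add: \<phi> distrib_left)
  qed
  have \<phi>_scale: "\<phi> (scaleC c x) = c * \<phi> x" for c x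
  proof -
    obtain X where X: "integrable circle_measure X" "x = abs_circle_L1 X" by (rule circle_L1_representative)
    have "scaleC c x = abs_circle_L1 (\<lambda>\<zeta>. c * X \<zeta>)" using X by (simp add: scaleC.abs_eq)
    then show ?thesis using X wX[OF X(1)] by (simp add: \<phi> mult.left_commute[of _ c])
  qed
  have dual: "\<phi> \<in> dual_space (punctured_H1 K)"
    unfolding dual_space_def using \<phi>_add \<phi>_scale \<phi>_bound by (auto intro!: exI[of _ 1])
  have wF: "w \<zeta> * F \<zeta> = of_real (norm (F \<zeta>))" for \<zeta>
  proof -
    have "w \<zeta> * F \<zeta> = F \<zeta> * cnj (F \<zeta>) / of_real (norm (F \<zeta>))"
      by (simp add: w_def sgn_div_norm scaleR_conv_of_real divide_inverse mult_ac)
    also have "\<dots> = of_real (norm (F \<zeta>))"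
      using nz[of \<zeta>] by (simp add: power2_eq_square flip: complex_norm_square)
    finally show ?thesis .
  qed
  have \<phi>_f: "\<phi> f = 1"
    unfolding fF \<phi>[OF F] wF integral_complex_of_real norm_F by simp
  have "dual_norm (punctured_H1 K) \<phi> = 1"
    unfolding dual_norm_def
  proof (rule antisym)
    have le: "norm (\<phi> x) \<le> 1" if "x \<in> unit_ball_of (punctured_H1 K)" for x
      using that \<phi>_bound[of x] by (simp add: unit_ball_of_def)
    show "(SUP x\<in>unit_ball_of (punctured_H1 K). norm (\<phi> x)) \<le> 1"
      using f_ball le by (intro cSUP_least) auto
    have "norm (\<phi> f) \<le> (SUP x\<in>unit_ball_of (punctured_H1 K). norm (\<phi> x))"
      using le by (intro cSUP_upper f_ball bdd_aboveI2)
    then show "1 \<le> (SUP x\<in>unit_ball_of (punctured_H1 K). norm (\<phi> x))" by (simp add: \<phi>_f)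
  qed
  moreover have "g = f" if g: "g \<in> unit_ball_of (punctured_H1 K)" "\<phi> g = 1" for g
  proof -
    obtain G where G: "integrable circle_measure G" "g = abs_circle_L1 G" by (rule circle_L1_representative)
    note [measurable] = borel_measurable_integrable[OF G(1)]
    have G_le: "(LINT \<zeta>|circle_measure. norm (G \<zeta>)) \<le> 1"
      using g(1) G by (simp add: unit_ball_of_def norm_abs_circle_L1)
    have wG: "(LINT \<zeta>|circle_measure. w \<zeta> * G \<zeta>) = 1"
      using g(2) \<phi>[OF G(1)] G(2) by simp
    have AE_wG: "AE \<zeta> in circle_measure. w \<zeta> * G \<zeta> = norm (G \<zeta>)"
      using AE_eq_if_integral_norm_le_pairing[OF G(1) _ G_le, of F] wG by (simp add: w_def)
    \<comment> \<open>equality in \<open>\<phi> g \<le> norm g\<close> means that \<open>G\<close> has the argument of \<open>F\<close>\<close>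
    define h where "h \<zeta> = norm (G \<zeta>) / norm (F \<zeta>)" for \<zeta>
    have [measurable]: "h \<in> borel_measurable circle_measure" unfolding h_def[abs_def] by measurable
    have G_hF: "AE \<zeta> in circle_measure. G \<zeta> = of_real (h \<zeta>) * F \<zeta>"
      using AE_wG
    proof eventually_elim
      case (elim \<zeta>)
      have "w \<zeta> * (of_real (h \<zeta>) * F \<zeta>) = of_real (h \<zeta>) * (w \<zeta> * F \<zeta>)" by (simp only: mult.left_commute)
      also have "\<dots> = of_real (norm (G \<zeta>))" unfolding wF using nz[of \<zeta>] by (simp add: h_def)
      finally have "w \<zeta> * G \<zeta> = w \<zeta> * (of_real (h \<zeta>) * F \<zeta>)" using elim by simp
      moreover have "w \<zeta> \<noteq> 0" using w_norm[of \<zeta>] by auto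
      ultimately show ?case by simp
    qed
    have hF: "integrable circle_measure (\<lambda>\<zeta>. of_real (h \<zeta>) * F \<zeta>)"
      using G(1) by (rule integrable_cong_AE_imp) (use G_hF in auto)
    have g_hF: "g = abs_circle_L1 (\<lambda>\<zeta>. of_real (h \<zeta>) * F \<zeta>)"
      using G hF G_hF by (simp add: abs_circle_L1_eq_iff)
    have "AE \<zeta> in circle_measure. h \<zeta> = (LINT \<zeta>|circle_measure. h \<zeta> * norm (F \<zeta>))"
    proof (rule positive_multiple_of_extreme_point[OF assms(1) _ F nz norm_F inv _ _ hF])
      show "abs_circle_L1 F extreme_point_of unit_ball_of (punctured_H1 K)" using assms(3) fF by simp
      show "abs_circle_L1 (\<lambda>\<zeta>. of_real (h \<zeta>) * F \<zeta>) \<in> punctured_H1 K"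
        using g(1) g_hF by (simp add: unit_ball_of_def)
      show "0 \<le> h \<zeta>" for \<zeta> by (simp add: h_def)
    qed measurable
    moreover have "(LINT \<zeta>|circle_measure. h \<zeta> * norm (F \<zeta>)) = 1"
    proof -
      have "(LINT \<zeta>|circle_measure. w \<zeta> * G \<zeta>) = (LINT \<zeta>|circle_measure. complex_of_real (h \<zeta> * norm (F \<zeta>)))"
        using AE_wG nz by (intro integral_cong_AE) (measurable, auto simp: h_def elim: eventually_mono)
      then show ?thesis using wG unfolding integral_complex_of_real by (metis of_real_eq_1_iff)
    qed
    ultimately have "AE \<zeta> in circle_measure. h \<zeta> = 1" by simp
    then have "AE \<zeta> in circle_measure. of_real (h \<zeta>) * F \<zeta> = F \<zeta>" by eventually_elim simp
    then show ?thesis unfolding g_hF fF using abs_circle_L1_eq_iff[OF hF F] by simp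
  qed
  then have "{g \<in> unit_ball_of (punctured_H1 K). \<phi> g = 1} = {f}"
    using f_ball \<phi>_f by blast
  ultimately show ?thesis
    unfolding exposed_point_of_ball_def using f_ball dual by blast
qed

end
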